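(* For every weak composition $a$, $\mathcal{A}_a=\mathfrak{Q}^{(1)}_a$.
   Context: A weak composition of length $n$ is a sequence of $n$ nonnegative integers. $D(a)$: $a_i$ left-justified boxes in row $i$, row 1 lowest. For a filling $S$, $x^{\mathrm{wt}(S)}=\prod_i x_i^{\#\{\text{entries } i\}}$. Demazure atom: a triple of $D(a)$ (rows $r<s$) is Type A: boxes $\gamma=(r,c),\alpha=(r,c+1),\beta=(s,c+1)$ with $a_r\ge a_s$, or Type B: $\gamma=(s,c),\alpha=(s,c+1),\beta=(r,c)$ with $a_s>a_r$; inversion triple if $\beta>\gamma\ge\alpha$ or $\gamma\ge\alpha>\beta$. $\mathcal{A}_a=\sum x^{\mathrm{wt}(S)}$ over fillings of $D(a)$ with positive integers, rows weakly decreasing left to right, distinct entries in each column, all triples inversion triples, and first-column entry of each nonempty row $i$ equal to $i$. Quasi-key tableau of shape $a$: filling of $D(a)$ with positive integers such that (1) entries weakly decrease along rows and no entry of row $i$ exceeds $i$; (2) entries in each column are distinct and increase going up the first column; (3) if an entry $i$ is above an entry $k$ in the same column with $i<k$, there is an entry $j$ immediately right of $k$ with $i<j$; (4) for two rows with the higher row strictly longer, if $i$ is in column $c$ of the lower row and $j$ in column $c+1$ of the higher row, then $i<j$. $\mathfrak{Q}^{(1)}_a=\sum x^{\mathrm{wt}(T)}$ over quasi-key tableaux $T$ of shape $a$ whose first-column entries equal their row indices. *)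

theory Defs
  imports Main "HOL-Library.Poly_Mapping"
begin

text \<open>A weak composition is a list of naturals; row i (1-indexed, row 1 lowest)
  has length a_i. Cells are pairs (row, column), both 1-indexed.
  A filling is a function on cells (values outside the diagram are irrelevant
  and required to be 0, so that the set of fillings is finite).\<close>

definition rowlen :: "nat list \<Rightarrow> nat \<Rightarrow> nat" where
  "rowlen a i = (if 1 \<le> i \<and> i \<le> length a then a ! (i - 1) else 0)"

definition diagram :: "nat list \<Rightarrow> (nat \<times> nat) set" where
  "diagram a = {(i, c). 1 \<le> i \<and> i \<le> length a \<and> 1 \<le> c \<and> c \<le> rowlen a i}"

definition is_filling :: "nat list \<Rightarrow> (nat \<times> nat \<Rightarrow> nat) \<Rightarrow> bool" where
  "is_filling a S \<longleftrightarrow> (\<forall>x. x \<notin> diagram a \<longrightarrow> S x = 0) \<and> (\<forall>x \<in> diagram a. 0 < S x)"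

definition wt :: "nat list \<Rightarrow> (nat \<times> nat \<Rightarrow> nat) \<Rightarrow> nat \<Rightarrow>\<^sub>0 nat" where
  "wt a S = Abs_poly_mapping (\<lambda>i. card {x \<in> diagram a. S x = i})"

definition genfun :: "nat list \<Rightarrow> ((nat \<times> nat \<Rightarrow> nat) \<Rightarrow> bool) \<Rightarrow> (nat \<Rightarrow>\<^sub>0 nat) \<Rightarrow>\<^sub>0 int" where
  "genfun a P = (\<Sum>S \<in> {S. is_filling a S \<and> P S}. Poly_Mapping.single (wt a S) 1)"

definition inv_cond :: "nat \<Rightarrow> nat \<Rightarrow> nat \<Rightarrow> bool" where
  "inv_cond g al b \<longleftrightarrow> (b > g \<and> g \<ge> al) \<or> (g \<ge> al \<and> al > b)"

definition atom_filling :: "nat list \<Rightarrow> (nat \<times> nat \<Rightarrow> nat) \<Rightarrow> bool" where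
  "atom_filling a S \<longleftrightarrow>
     \<comment> \<open>rows weakly decreasing\<close>
     (\<forall>i c. (i, c) \<in> diagram a \<and> (i, c + 1) \<in> diagram a \<longrightarrow> S (i, c + 1) \<le> S (i, c)) \<and>
     \<comment> \<open>distinct column entries\<close>
     (\<forall>r s c. (r, c) \<in> diagram a \<and> (s, c) \<in> diagram a \<and> r \<noteq> s \<longrightarrow> S (r, c) \<noteq> S (s, c)) \<and>
     \<comment> \<open>type A triples are inversion triples\<close>
     (\<forall>r s c. r < s \<and> rowlen a r \<ge> rowlen a s \<and>
        (r, c) \<in> diagram a \<and> (r, c + 1) \<in> diagram a \<and> (s, c + 1) \<in> diagram a \<longrightarrow>
        inv_cond (S (r, c)) (S (r, c + 1)) (S (s, c + 1))) \<and>
     \<comment> \<open>type B triples are inversion triples\<close>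
     (\<forall>r s c. r < s \<and> rowlen a s > rowlen a r \<and>
        (s, c) \<in> diagram a \<and> (s, c + 1) \<in> diagram a \<and> (r, c) \<in> diagram a \<longrightarrow>
        inv_cond (S (s, c)) (S (s, c + 1)) (S (r, c))) \<and>
     \<comment> \<open>first column entry of each nonempty row i is i\<close>
     (\<forall>i. (i, 1) \<in> diagram a \<longrightarrow> S (i, 1) = i)"

definition demazure_atom :: "nat list \<Rightarrow> (nat \<Rightarrow>\<^sub>0 nat) \<Rightarrow>\<^sub>0 int" where
  "demazure_atom a = genfun a (atom_filling a)"

definition quasi_key :: "nat list \<Rightarrow> (nat \<times> nat \<Rightarrow> nat) \<Rightarrow> bool" where
  "quasi_key a T \<longleftrightarrow>
     \<comment> \<open>(1)\<close>
     (\<forall>i c. (i, c) \<in> diagram a \<and> (i, c + 1) \<in> diagram a \<longrightarrow> T (i, c + 1) \<le> T (i, c)) \<and>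
     (\<forall>i c. (i, c) \<in> diagram a \<longrightarrow> T (i, c) \<le> i) \<and>
     \<comment> \<open>(2)\<close>
     (\<forall>r s c. (r, c) \<in> diagram a \<and> (s, c) \<in> diagram a \<and> r \<noteq> s \<longrightarrow> T (r, c) \<noteq> T (s, c)) \<and>
     (\<forall>r s. r < s \<and> (r, 1) \<in> diagram a \<and> (s, 1) \<in> diagram a \<longrightarrow> T (r, 1) < T (s, 1)) \<and>
     \<comment> \<open>(3)\<close>
     (\<forall>r s c. r < s \<and> (r, c) \<in> diagram a \<and> (s, c) \<in> diagram a \<and> T (s, c) < T (r, c) \<longrightarrow>
        (r, c + 1) \<in> diagram a \<and> T (s, c) < T (r, c + 1)) \<and>
     \<comment> \<open>(4)\<close>
     (\<forall>r s c. r < s \<and> rowlen a r < rowlen a s \<and> (r, c) \<in> diagram a \<and> (s, c + 1) \<in> diagram a \<longrightarrow>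
        T (r, c) < T (s, c + 1))"

definition quasi_key_poly1 :: "nat list \<Rightarrow> (nat \<Rightarrow>\<^sub>0 nat) \<Rightarrow>\<^sub>0 int" where
  "quasi_key_poly1 a = genfun a (\<lambda>T. quasi_key a T \<and> (\<forall>i. (i, 1) \<in> diagram a \<longrightarrow> T (i, 1) = i))"

end

theory Submission
  imports Defs "HOL-Library.Infinite_Set"
begin

text \<open>
  Both kinds of fillings are determined by their sets of column entries, and the same sequences
  of column sets K occur for both, so that the weights agree.

  In an atom filling, the entries of column c + 1 in the rows up to t are those elements of
  K (c + 1) that get matched when K (c + 1) is scanned downwards and each element is matched with a
  weakly larger entry of column c in the rows up to t. In a quasi-key tableau, the entries of
  column c in the rows longer than m are those elements of K c that get matched when K c is scanned
  upwards and each element is matched with a weakly smaller entry of column c + 1 in these rows.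
  Hence the atom conditions build the shape from left to right and the quasi-key conditions
  from right to left. The two shapes agree because the size of a maximum matching between sets is
  given by a min-max formula, from which matching W into D and the result into U gives the same
  number as matching W into the part of D that can be matched into U.
\<close>

section \<open>Matching numbers and greedily matched sets\<close>

text \<open>By Koenig's theorem this is the size of a maximum matching between W and U in the graph
  whose edges are the pairs w \<le> u: the sets counted here form a vertex cover for every k.\<close>

definition mnum :: "nat set \<Rightarrow> nat set \<Rightarrow> nat" where
  "mnum W U = (LEAST n. \<exists>k. n = card (W \<inter> {..<k}) + card (U \<inter> {k..}))"

text \<open>For finite sets this is the greedy basis, from below, of the transversal matroid on
  \<open>D\<close>. Recording where the matching number jumps describes the scan without building a
  matching.\<close>

definition matched_up :: "nat set \<Rightarrow> nat set \<Rightarrow> nat set" where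
  "matched_up W D = {d \<in> D. mnum W (D \<inter> {..<d}) < mnum W (D \<inter> {..d})}"

definition matched_down :: "nat set \<Rightarrow> nat set \<Rightarrow> nat set" where
  "matched_down D U = {d \<in> D. mnum (D \<inter> {d<..}) U < mnum (D \<inter> {d..}) U}"

lemma mnum_le: "mnum W U \<le> card (W \<inter> {..<k}) + card (U \<inter> {k..})"
  unfolding mnum_def by (rule Least_le) blast

lemma mnum_witness: obtains k where "mnum W U = card (W \<inter> {..<k}) + card (U \<inter> {k..})"
proof -
  have "\<exists>k. mnum W U = card (W \<inter> {..<k}) + card (U \<inter> {k..})"
    unfolding mnum_def by (rule LeastI_ex) blast
  with that show thesis by blast
qed

lemma mnum_empty_right [simp]: "mnum W {} = 0"
  using mnum_le[of W "{}" 0] by simp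

lemma mnum_empty_left [simp]:
  assumes "finite U"
  shows "mnum {} U = 0"
proof -
  obtain N where "U \<subseteq> {..<N}" using assms by (meson finite_nat_iff_bounded)
  then have "U \<inter> {N..} = {}" by auto
  then show ?thesis using mnum_le[of "{}" U N] by simp
qed

lemma matched_up_subset: "matched_up W D \<subseteq> D" and matched_down_subset: "matched_down D U \<subseteq> D"
  by (auto simp: matched_up_def matched_down_def)

lemma finite_matched [simp]:
  "finite D \<Longrightarrow> finite (matched_up W D)" "finite D \<Longrightarrow> finite (matched_down D U)"
  by (meson matched_up_subset matched_down_subset finite_subset)+

text \<open>A cover with threshold at most \<open>d\<close> pays one for the new vertex
  \<open>d\<close>; one with a larger threshold already contains every element of \<open>W\<close>
  up to \<open>d\<close>. So \<open>d\<close> is matched exactly when such an element is still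
  free.\<close>

lemma mnum_Suc_right:
  assumes "finite W" "finite D" "d \<in> D"
  shows "mnum W (D \<inter> {..d}) = min (Suc (mnum W (D \<inter> {..<d}))) (card (W \<inter> {..d}))"
proof (rule antisym)
  obtain k where k: "mnum W (D \<inter> {..<d}) = card (W \<inter> {..<k}) + card (D \<inter> {..<d} \<inter> {k..})"
    by (rule mnum_witness)
  have "D \<inter> {..d} \<inter> {k..} \<subseteq> insert d (D \<inter> {..<d} \<inter> {k..})" by auto
  then have "card (D \<inter> {..d} \<inter> {k..}) \<le> card (insert d (D \<inter> {..<d} \<inter> {k..}))"
    using assms by (intro card_mono) auto
  also have "\<dots> \<le> Suc (card (D \<inter> {..<d} \<inter> {k..}))"
    using assms by (simp add: card_insert_if)
  finally have "mnum W (D \<inter> {..d}) \<le> Suc (mnum W (D \<inter> {..<d}))"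
    using k mnum_le[of W "D \<inter> {..d}" k] by linarith
  moreover have "D \<inter> {..d} \<inter> {Suc d..} = {}" by auto
  then have "mnum W (D \<inter> {..d}) \<le> card (W \<inter> {..d})"
    using mnum_le[of W "D \<inter> {..d}" "Suc d"] by (simp add: lessThan_Suc_atMost)
  ultimately show "mnum W (D \<inter> {..d}) \<le> min (Suc (mnum W (D \<inter> {..<d}))) (card (W \<inter> {..d}))"
    by simp
next
  obtain k where k: "mnum W (D \<inter> {..d}) = card (W \<inter> {..<k}) + card (D \<inter> {..d} \<inter> {k..})"
    by (rule mnum_witness)
  show "min (Suc (mnum W (D \<inter> {..<d}))) (card (W \<inter> {..d})) \<le> mnum W (D \<inter> {..d})"
  proof (cases "k \<le> d")
    case True
    have "D \<inter> {..d} \<inter> {k..} = insert d (D \<inter> {..<d} \<inter> {k..})" using assms True by auto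
    then have "card (D \<inter> {..d} \<inter> {k..}) = Suc (card (D \<inter> {..<d} \<inter> {k..}))" using assms by simp
    then show ?thesis using k mnum_le[of W "D \<inter> {..<d}" k] by linarith
  next
    case False
    then have "card (W \<inter> {..d}) \<le> card (W \<inter> {..<k})"
      using assms by (intro card_mono) auto
    then show ?thesis using k by linarith
  qed
qed

text \<open>Mirror image of \<open>mnum_Suc_right\<close>: the new vertex \<open>d\<close> is the
  least one, and its partners are the elements of \<open>U\<close> from \<open>d\<close> on.\<close>

lemma mnum_Suc_left:
  assumes "finite U" "finite D" "d \<in> D"
  shows "mnum (D \<inter> {d..}) U = min (Suc (mnum (D \<inter> {d<..}) U)) (card (U \<inter> {d..}))"
proof (rule antisym)
  obtain k where k: "mnum (D \<inter> {d<..}) U = card (D \<inter> {d<..} \<inter> {..<k}) + card (U \<inter> {k..})"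
    by (rule mnum_witness)
  have "D \<inter> {d..} \<inter> {..<k} \<subseteq> insert d (D \<inter> {d<..} \<inter> {..<k})" by auto
  then have "card (D \<inter> {d..} \<inter> {..<k}) \<le> card (insert d (D \<inter> {d<..} \<inter> {..<k}))"
    using assms by (intro card_mono) auto
  also have "\<dots> \<le> Suc (card (D \<inter> {d<..} \<inter> {..<k}))"
    using assms by (simp add: card_insert_if)
  finally have "mnum (D \<inter> {d..}) U \<le> Suc (mnum (D \<inter> {d<..}) U)"
    using k mnum_le[of "D \<inter> {d..}" U k] by linarith
  moreover have "D \<inter> {d..} \<inter> {..<d} = {}" by auto
  then have "mnum (D \<inter> {d..}) U \<le> card (U \<inter> {d..})"
    using mnum_le[of "D \<inter> {d..}" U d] by simp
  ultimately show "mnum (D \<inter> {d..}) U \<le> min (Suc (mnum (D \<inter> {d<..}) U)) (card (U \<inter> {d..}))"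
    by simp
next
  obtain k where k: "mnum (D \<inter> {d..}) U = card (D \<inter> {d..} \<inter> {..<k}) + card (U \<inter> {k..})"
    by (rule mnum_witness)
  show "min (Suc (mnum (D \<inter> {d<..}) U)) (card (U \<inter> {d..})) \<le> mnum (D \<inter> {d..}) U"
  proof (cases "d < k")
    case True
    have "D \<inter> {d..} \<inter> {..<k} = insert d (D \<inter> {d<..} \<inter> {..<k})" using assms True by auto
    then have "card (D \<inter> {d..} \<inter> {..<k}) = Suc (card (D \<inter> {d<..} \<inter> {..<k}))" using assms by simp
    then show ?thesis using k mnum_le[of "D \<inter> {d<..}" U k] by linarith
  next
    case False
    then have "card (U \<inter> {d..}) \<le> card (U \<inter> {k..})"
      using assms by (intro card_mono) auto
    then show ?thesis using k by linarith
  qed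
qed

lemma mnum_le_card_right: "mnum W (D \<inter> {..<d}) \<le> card (W \<inter> {..<d})"
proof -
  have "D \<inter> {..<d} \<inter> {d..} = {}" by auto
  then show ?thesis using mnum_le[of W "D \<inter> {..<d}" d] by simp
qed

lemma mnum_le_card_left: "mnum (D \<inter> {d<..}) U \<le> card (U \<inter> {d<..})"
proof -
  have "D \<inter> {d<..} \<inter> {..<Suc d} = {}" by auto
  moreover have "{Suc d..} = {d<..}" by auto
  ultimately show ?thesis using mnum_le[of "D \<inter> {d<..}" U "Suc d"] by simp
qed

lemma card_Int_mono: "finite W \<Longrightarrow> A \<subseteq> B \<Longrightarrow> card (W \<inter> A) \<le> card (W \<inter> B)"
  by (intro card_mono) auto

text \<open>The matching number grows by at most one at each element of \<open>D\<close> and never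
  drops, so its value is the number of jumps.\<close>

lemma card_matched_up:
  assumes "finite W" "finite D"
  shows "card (matched_up W D \<inter> {..<t}) = mnum W (D \<inter> {..<t})"
proof (induction t)
  case (Suc t)
  have fin: "finite (matched_up W D)" using assms by simp
  show ?case
  proof (cases "t \<in> D")
    case True
    have le: "mnum W (D \<inter> {..<t}) \<le> card (W \<inter> {..t})"
      by (rule order_trans[OF mnum_le_card_right card_Int_mono[OF assms(1)]]) auto
    have step: "mnum W (D \<inter> {..t}) = min (Suc (mnum W (D \<inter> {..<t}))) (card (W \<inter> {..t}))"
      using mnum_Suc_right[OF assms True] .
    show ?thesis
    proof (cases "t \<in> matched_up W D")
      case in_up: True
      then have "matched_up W D \<inter> {..<Suc t} = insert t (matched_up W D \<inter> {..<t})" by auto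
      then have "card (matched_up W D \<inter> {..<Suc t}) = Suc (mnum W (D \<inter> {..<t}))"
        using fin Suc.IH by simp
      then show ?thesis using in_up step by (auto simp: matched_up_def lessThan_Suc_atMost)
    next
      case notin: False
      then have "matched_up W D \<inter> {..<Suc t} = matched_up W D \<inter> {..<t}"
        by (auto simp: less_Suc_eq)
      then show ?thesis using notin step le True Suc.IH
        by (auto simp: matched_up_def lessThan_Suc_atMost)
    qed
  next
    case False
    then have "D \<inter> {..<Suc t} = D \<inter> {..<t}" by (auto simp: less_Suc_eq)
    moreover have "matched_up W D \<inter> {..<Suc t} = matched_up W D \<inter> {..<t}"
      using False matched_up_subset[of W D] by (auto simp: less_Suc_eq)
    ultimately show ?thesis using Suc.IH by simp
  qed
qed simp

lemma card_matched_down: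
  assumes "finite D" "finite U"
  shows "card (matched_down D U \<inter> {s..}) = mnum (D \<inter> {s..}) U"
proof -
  have fin: "finite (matched_down D U)" using assms by simp
  \<comment> \<open>The downward scan starts from a bound \<open>N\<close>, beyond which
    \<open>D\<close> has nothing to match.\<close>
  obtain N where N: "D \<subseteq> {..<N}" using assms by (meson finite_nat_iff_bounded)
  have large: "card (matched_down D U \<inter> {s..}) = mnum (D \<inter> {s..}) U" if "N \<le> s" for s
  proof -
    have "D \<inter> {s..} = {}" using N that by auto
    moreover from this have "matched_down D U \<inter> {s..} = {}" using matched_down_subset by blast
    ultimately show ?thesis using assms by simp
  qed
  have "card (matched_down D U \<inter> {s..}) = mnum (D \<inter> {s..}) U" if "s \<le> N" for s
    using that
  proof (induction rule: inc_induct)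
    case base
    then show ?case by (simp add: large)
  next
    case (step t)
    have Suc_eq: "{Suc t..} = {t<..}" by auto
    note IH = step.IH[unfolded Suc_eq]
    show ?case
    proof (cases "t \<in> D")
      case True
      have le: "mnum (D \<inter> {t<..}) U \<le> card (U \<inter> {t..})"
        by (rule order_trans[OF mnum_le_card_left card_Int_mono[OF assms(2)]]) auto
      have rec: "mnum (D \<inter> {t..}) U = min (Suc (mnum (D \<inter> {t<..}) U)) (card (U \<inter> {t..}))"
        using mnum_Suc_left[OF assms(2,1) True] .
      show ?thesis
      proof (cases "t \<in> matched_down D U")
        case in_down: True
        then have "matched_down D U \<inter> {t..} = insert t (matched_down D U \<inter> {t<..})" by auto
        then have "card (matched_down D U \<inter> {t..}) = Suc (mnum (D \<inter> {t<..}) U)"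
          using fin IH by simp
        then show ?thesis using in_down rec by (auto simp: matched_down_def)
      next
        case notin: False
        then have "matched_down D U \<inter> {t..} = matched_down D U \<inter> {t<..}"
          by (auto simp: le_less)
        then show ?thesis using notin rec le True IH by (auto simp: matched_down_def)
      qed
    next
      case False
      then have "D \<inter> {t..} = D \<inter> {t<..}" by (auto simp: le_less)
      moreover have "matched_down D U \<inter> {t..} = matched_down D U \<inter> {t<..}"
        using False matched_down_subset[of D U] by (force simp: le_less)
      ultimately show ?thesis using IH by simp
    qed
  qed
  then show ?thesis using large by (cases "s \<le> N") auto
qed

text \<open>Both sides are the minimum over s and t of
  card (W \<inter> {..<s}) + card (D \<inter> {s..<t}) + card (U \<inter> {t..}).\<close>

lemma mnum_matched_up_eq_mnum_matched_down:
  assumes "finite W" "finite D" "finite U"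
  shows "mnum (matched_up W D) U = mnum W (matched_down D U)"
proof (rule antisym)
  obtain s where s: "mnum W (matched_down D U) = card (W \<inter> {..<s}) + card (matched_down D U \<inter> {s..})"
    by (rule mnum_witness)
  obtain t where t: "mnum (D \<inter> {s..}) U = card (D \<inter> {s..} \<inter> {..<t}) + card (U \<inter> {t..})"
    by (rule mnum_witness)
  have "mnum (matched_up W D) U \<le> mnum W (D \<inter> {..<t}) + card (U \<inter> {t..})"
    using mnum_le[of "matched_up W D" U t] card_matched_up[OF assms(1,2)] by simp
  also have "\<dots> \<le> card (W \<inter> {..<s}) + card (D \<inter> {..<t} \<inter> {s..}) + card (U \<inter> {t..})"
    using mnum_le[of W "D \<inter> {..<t}" s] by simp
  also have "\<dots> = mnum W (matched_down D U)"
    using s t card_matched_down[OF assms(2,3)] by (simp add: Int_ac)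
  finally show "mnum (matched_up W D) U \<le> mnum W (matched_down D U)" .
next
  obtain t where t: "mnum (matched_up W D) U = card (matched_up W D \<inter> {..<t}) + card (U \<inter> {t..})"
    by (rule mnum_witness)
  obtain s where s: "mnum W (D \<inter> {..<t}) = card (W \<inter> {..<s}) + card (D \<inter> {..<t} \<inter> {s..})"
    by (rule mnum_witness)
  have "mnum W (matched_down D U) \<le> card (W \<inter> {..<s}) + mnum (D \<inter> {s..}) U"
    using mnum_le[of W "matched_down D U" s] card_matched_down[OF assms(2,3)] by simp
  also have "\<dots> \<le> card (W \<inter> {..<s}) + (card (D \<inter> {s..} \<inter> {..<t}) + card (U \<inter> {t..}))"
    using mnum_le[of "D \<inter> {s..}" U t] by simp
  also have "\<dots> = mnum (matched_up W D) U"
    using s t card_matched_up[OF assms(1,2)] by (simp add: Int_ac)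
  finally show "mnum W (matched_down D U) \<le> mnum (matched_up W D) U" .
qed

lemma mem_matched_up_iff:
  assumes "finite W" "finite D" "d \<in> D"
  shows "d \<in> matched_up W D \<longleftrightarrow> card (matched_up W D \<inter> {..<d}) < card (W \<inter> {..d})"
  using mnum_Suc_right[OF assms] card_matched_up[OF assms(1,2)] assms(3)
  by (auto simp: matched_up_def)

lemma mem_matched_down_iff:
  assumes "finite D" "finite U" "d \<in> D"
  shows "d \<in> matched_down D U \<longleftrightarrow> card (matched_down D U \<inter> {d<..}) < card (U \<inter> {d..})"
proof -
  have "{Suc d..} = {d<..}" by auto
  then show ?thesis
    using mnum_Suc_left[OF assms(2,1,3)] card_matched_down[OF assms(1,2), of "Suc d"] assms(3)
    by (auto simp: matched_down_def)
qed

text \<open>Under the greedy rule the membership of \<open>d\<close> depends only on smaller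
  elements, so induction fixes \<open>X\<close>. This serves to recognise columns of fillings as
  matched sets.\<close>

lemma matched_up_unique:
  assumes "finite W" "finite D" "X \<subseteq> D"
    and greedy: "\<And>d. d \<in> D \<Longrightarrow> d \<in> X \<longleftrightarrow> card (X \<inter> {..<d}) < card (W \<inter> {..d})"
  shows "X = matched_up W D"
proof -
  have "d \<in> X \<longleftrightarrow> d \<in> matched_up W D" for d
  proof (induction d rule: less_induct)
    case (less d)
    then have "X \<inter> {..<d} = matched_up W D \<inter> {..<d}" by auto
    then show ?case
      using greedy[of d] mem_matched_up_iff[OF assms(1,2), of d] assms(3) matched_up_subset[of W D]
      by (cases "d \<in> D") auto
  qed
  then show ?thesis by blast
qed

lemma matched_down_unique:
  assumes "finite D" "finite U" "X \<subseteq> D"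
    and greedy: "\<And>d. d \<in> D \<Longrightarrow> d \<in> X \<longleftrightarrow> card (X \<inter> {d<..}) < card (U \<inter> {d..})"
  shows "X = matched_down D U"
proof -
  obtain N where N: "D \<subseteq> {..<N}" using assms by (meson finite_nat_iff_bounded)
  have "d \<in> X \<longleftrightarrow> d \<in> matched_down D U" for d
  \<comment> \<open>The measure \<open>N - d\<close> treats the larger elements first.\<close>
  proof (induction "N - d" arbitrary: d rule: less_induct)
    case less
    show ?case
    proof (cases "d \<in> D")
      case True
      with N have "d < N" by auto
      then have "X \<inter> {d<..} = matched_down D U \<inter> {d<..}" using less by auto
      then show ?thesis
        using greedy[of d] mem_matched_down_iff[OF assms(1,2), of d] True by auto
    next
      case False
      then show ?thesis using assms(3) matched_down_subset[of D U] by auto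
    qed
  qed
  then show ?thesis by blast
qed

lemma card_Diff_Int:
  assumes "finite B" "A \<subseteq> B"
  shows "card (B \<inter> I) = card (A \<inter> I) + card ((B - A) \<inter> I)"
proof -
  have "B \<inter> I = (A \<inter> I) \<union> ((B - A) \<inter> I)" using assms by auto
  then show ?thesis using assms by (metis Diff_disjoint Int_Diff Int_assoc card_Un_disjoint
      finite_Int finite_subset inf_bot_right inf_commute inf_left_commute)
qed

text \<open>An optimal cover for \<open>V\<close> becomes one for \<open>W\<close> by adding the
  elements of \<open>W - V\<close> below its threshold. A threshold above \<open>t\<close> is first
  lowered to \<open>t\<close>.\<close>

lemma mnum_right_diff_le:
  assumes "finite W" "V \<subseteq> W"
  shows "mnum W (D \<inter> {..<t}) \<le> mnum V (D \<inter> {..<t}) + card ((W - V) \<inter> {..<t})"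
proof -
  obtain k where k: "mnum V (D \<inter> {..<t}) = card (V \<inter> {..<k}) + card (D \<inter> {..<t} \<inter> {k..})"
    by (rule mnum_witness)
  have W: "card (W \<inter> {..<j}) = card (V \<inter> {..<j}) + card ((W - V) \<inter> {..<j})" for j
    using card_Diff_Int assms by blast
  show ?thesis
  proof (cases "k \<le> t")
    case True
    then have "card ((W - V) \<inter> {..<k}) \<le> card ((W - V) \<inter> {..<t})"
      using assms by (intro card_Int_mono) auto
    then show ?thesis using k mnum_le[of W "D \<inter> {..<t}" k] W[of k] by linarith
  next
    case False
    then have "card (V \<inter> {..<t}) \<le> card (V \<inter> {..<k})"
      using assms finite_subset by (intro card_Int_mono) auto
    then show ?thesis using k mnum_le_card_right[of W D t] W[of t] by linarith
  qed
qed

lemma mnum_left_diff_le: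
  assumes "finite U" "V \<subseteq> U"
  shows "mnum (D \<inter> {s..}) U \<le> mnum (D \<inter> {s..}) V + card ((U - V) \<inter> {s..})"
proof -
  obtain k where k: "mnum (D \<inter> {s..}) V = card (D \<inter> {s..} \<inter> {..<k}) + card (V \<inter> {k..})"
    by (rule mnum_witness)
  have U: "card (U \<inter> {j..}) = card (V \<inter> {j..}) + card ((U - V) \<inter> {j..})" for j
    using card_Diff_Int assms by blast
  show ?thesis
  proof (cases "s \<le> k")
    case True
    then have "card ((U - V) \<inter> {k..}) \<le> card ((U - V) \<inter> {s..})"
      using assms by (intro card_Int_mono) auto
    then show ?thesis using k mnum_le[of "D \<inter> {s..}" U k] U[of k] by linarith
  next
    case False
    then have "card (V \<inter> {s..}) \<le> card (V \<inter> {k..})"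
      using assms finite_subset by (intro card_Int_mono) auto
    moreover have "D \<inter> {s..} \<inter> {..<s} = {}" by auto
    then have "mnum (D \<inter> {s..}) U \<le> card (U \<inter> {s..})"
      using mnum_le[of "D \<inter> {s..}" U s] by simp
    ultimately show ?thesis using k U[of s] by linarith
  qed
qed

text \<open>Passing from \<open>V\<close> to \<open>W\<close> adds at least as many partners up to
  \<open>d\<close> as chosen elements below \<open>d\<close>, so the greedy rule still accepts
  \<open>d\<close>.\<close>

lemma matched_up_mono:
  assumes "finite W" "finite D" "V \<subseteq> W"
  shows "matched_up V D \<subseteq> matched_up W D"
proof
  fix d assume d: "d \<in> matched_up V D"
  have fV: "finite V" using assms finite_subset by blast
  have dD: "d \<in> D" using d matched_up_subset by blast
  have "card (matched_up V D \<inter> {..<d}) < card (V \<inter> {..d})"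
    using d mem_matched_up_iff[OF fV assms(2) dD] by simp
  moreover have "card (W \<inter> {..d}) = card (V \<inter> {..d}) + card ((W - V) \<inter> {..d})"
    using card_Diff_Int assms by blast
  moreover have "card ((W - V) \<inter> {..<d}) \<le> card ((W - V) \<inter> {..d})"
    using assms by (intro card_Int_mono) auto
  ultimately show "d \<in> matched_up W D"
    using mem_matched_up_iff[OF assms(1,2) dD] card_matched_up[OF assms(1,2)]
      card_matched_up[OF fV assms(2)] mnum_right_diff_le[OF assms(1,3), of D d] by simp
qed

lemma matched_down_mono:
  assumes "finite D" "finite U" "V \<subseteq> U"
  shows "matched_down D V \<subseteq> matched_down D U"
proof
  fix d assume d: "d \<in> matched_down D V"
  have fV: "finite V" using assms finite_subset by blast
  have dD: "d \<in> D" using d matched_down_subset by blast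
  have Suc_eq: "{d<..} = {Suc d..}" by auto
  have "card (matched_down D V \<inter> {Suc d..}) < card (V \<inter> {d..})"
    using d mem_matched_down_iff[OF assms(1) fV dD] Suc_eq by simp
  moreover have "card (U \<inter> {d..}) = card (V \<inter> {d..}) + card ((U - V) \<inter> {d..})"
    using card_Diff_Int assms by blast
  moreover have "card ((U - V) \<inter> {Suc d..}) \<le> card ((U - V) \<inter> {d..})"
    using assms by (intro card_Int_mono) auto
  ultimately show "d \<in> matched_down D U"
    using mem_matched_down_iff[OF assms(1,2) dD] card_matched_down[OF assms(1,2)]
      card_matched_down[OF assms(1) fV] mnum_left_diff_le[OF assms(2,3), of D "Suc d"]
    by (simp add: Suc_eq)
qed

text \<open>This will give weakly decreasing rows: when rows are added, their entries in one column
  are the gained elements, and their entries in the next column form \<open>W - V\<close>.\<close>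

lemma card_matched_up_Diff_le:
  assumes "finite W" "finite D" "V \<subseteq> W"
  shows "card ((matched_up W D - matched_up V D) \<inter> {..<t}) \<le> card ((W - V) \<inter> {..<t})"
proof -
  have fV: "finite V" using assms finite_subset by blast
  show ?thesis
    using mnum_right_diff_le[OF assms(1,3), of D t] card_matched_up[OF assms(1,2), of t]
      card_matched_up[OF fV assms(2), of t]
      card_Diff_Int[OF _ matched_up_mono[OF assms], of "{..<t}"] assms(2) by simp
qed

lemma card_matched_down_Diff_le:
  assumes "finite D" "finite U" "V \<subseteq> U"
  shows "card ((matched_down D U - matched_down D V) \<inter> {s..}) \<le> card ((U - V) \<inter> {s..})"
proof -
  have fV: "finite V" using assms finite_subset by blast
  show ?thesis
    using mnum_left_diff_le[OF assms(2,3), of D s] card_matched_down[OF assms(1,2), of s]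
      card_matched_down[OF assms(1) fV, of s]
      card_Diff_Int[OF _ matched_down_mono[OF assms], of "{s..}"] assms(1) by simp
qed

lemma card_matched_up_le:
  assumes "finite W" "finite D"
  shows "card (matched_up W D) \<le> card W"
proof -
  obtain N where N: "D \<subseteq> {..<N}" using assms by (meson finite_nat_iff_bounded)
  then have "matched_up W D \<inter> {..<N} = matched_up W D" using matched_up_subset by blast
  then have "card (matched_up W D) \<le> card (W \<inter> {..<N})"
    using card_matched_up[OF assms, of N] mnum_le_card_right[of W D N] by simp
  also have "\<dots> \<le> card W" using assms by (intro card_mono) auto
  finally show ?thesis .
qed

text \<open>The scan rejects \<open>d\<close> only when all elements of \<open>W\<close> up to
  \<open>d\<close> are in use.\<close>

lemma card_matched_up_tight:
  assumes "finite W" "finite D" "d \<in> D" "d \<notin> matched_up W D"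
  shows "card (matched_up W D \<inter> {..d}) = card (W \<inter> {..d})"
proof -
  have "matched_up W D \<inter> {..d} = matched_up W D \<inter> {..<d}"
    using assms(4) by (auto simp: le_less)
  then show ?thesis
    using mem_matched_up_iff[OF assms(1-3)] assms(4) card_matched_up[OF assms(1,2), of d]
      order_trans[OF mnum_le_card_right[of W D d] card_Int_mono[OF assms(1)], of "{..d}"]
    by (simp add: subset_eq)
qed

lemma card_matched_down_tight:
  assumes "finite D" "finite U" "d \<in> D" "d \<notin> matched_down D U"
  shows "card (matched_down D U \<inter> {d..}) = card (U \<inter> {d..})"
proof -
  have Suc_eq: "{d<..} = {Suc d..}" by auto
  have "matched_down D U \<inter> {d..} = matched_down D U \<inter> {d<..}"
    using assms(4) by (auto simp: le_less)
  then show ?thesis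
    using mem_matched_down_iff[OF assms(1-3)] assms(4) card_matched_down[OF assms(1,2), of "Suc d"]
      order_trans[OF mnum_le_card_left[of D d U] card_Int_mono[OF assms(2)], of "{d..}"]
    by (simp add: Suc_eq subset_eq)
qed

lemma card_image_Int:
  assumes "inj_on f A"
  shows "card (f ` A \<inter> I) = card {r \<in> A. f r \<in> I}"
proof -
  have "f ` A \<inter> I = f ` {r \<in> A. f r \<in> I}" by auto
  then show ?thesis using assms by (metis (no_types, lifting) card_image inj_on_subset mem_Collect_eq subsetI)
qed

lemma set_eq_if_card_atMost_eq:
  fixes A B :: "nat set"
  assumes "finite A" "finite B" and eq: "\<And>t. card (A \<inter> {..t}) = card (B \<inter> {..t})"
  shows "A = B"
proof -
  have card_step: "card (S \<inter> {..t}) = card (S \<inter> {..<t}) + (if t \<in> S then 1 else 0)"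
    if "finite S" for S :: "nat set" and t
  proof -
    have "S \<inter> {..t} = (if t \<in> S then insert t (S \<inter> {..<t}) else S \<inter> {..<t})"
      by (auto simp: le_less)
    then show ?thesis using that by auto
  qed
  have "card (A \<inter> {..<t}) = card (B \<inter> {..<t})" for t
    using eq by (cases t) (auto simp: lessThan_Suc_atMost)
  then have "t \<in> A \<longleftrightarrow> t \<in> B" for t
    using card_step[OF assms(1), of t] card_step[OF assms(2), of t] eq[of t] by (auto split: if_splits)
  then show ?thesis by blast
qed

section \<open>Iterated matching along the columns\<close>

text \<open>For the column sets K of an atom filling, low_col K t c consists of the entries of column c
  in the rows up to t. For those of a quasi-key tableau, long_col K c n consists of the entries of
  column c in the rows that have a column c + n.\<close>

primrec low_col :: "(nat \<Rightarrow> nat set) \<Rightarrow> nat \<Rightarrow> nat \<Rightarrow> nat set" where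
  "low_col K t 0 = K 0 \<inter> {..t}"
| "low_col K t (Suc c) = matched_down (K (Suc c)) (low_col K t c)"

primrec long_col :: "(nat \<Rightarrow> nat set) \<Rightarrow> nat \<Rightarrow> nat \<Rightarrow> nat set" where
  "long_col K c 0 = K c"
| "long_col K c (Suc n) = matched_up (long_col K (Suc c) n) (K c)"

lemma low_col_subset: "low_col K t c \<subseteq> K c"
  by (cases c) (auto simp: matched_down_def)

lemma long_col_subset: "long_col K c n \<subseteq> K c"
  by (cases n) (auto simp: matched_up_def)

locale finite_columns =
  fixes K :: "nat \<Rightarrow> nat set"
  assumes fin_K: "finite (K c)"
begin

lemma finite_low_col: "finite (low_col K t c)"
  by (rule finite_subset[OF low_col_subset fin_K])

lemma finite_long_col: "finite (long_col K c n)"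
  by (rule finite_subset[OF long_col_subset fin_K])

lemma low_col_mono: "t \<le> t' \<Longrightarrow> low_col K t c \<subseteq> low_col K t' c"
proof (induction c)
  case (Suc c)
  then show ?case using matched_down_mono[OF fin_K finite_low_col] by simp
qed auto

lemma long_col_Suc_subset: "long_col K c (Suc n) \<subseteq> long_col K c n"
proof (induction n arbitrary: c)
  case 0
  then show ?case using matched_up_subset by simp
next
  case (Suc n)
  show ?case using matched_up_mono[OF finite_long_col fin_K Suc.IH] by simp
qed

text \<open>Each step applies \<open>mnum_matched_up_eq_mnum_matched_down\<close> at one column,
  trading an upward match from the right for a downward match from the left, until only the latter
  is left to count.\<close>

lemma mnum_long_col_low_col:
  "mnum (long_col K (Suc c) n) (low_col K t c) = card (low_col K t (Suc (c + n)))"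
proof (induction n arbitrary: c)
  case 0
  show ?case using card_matched_down[OF fin_K finite_low_col, of "Suc c" t c 0] by simp
next
  case (Suc n)
  have "mnum (long_col K (Suc c) (Suc n)) (low_col K t c)
      = mnum (long_col K (Suc (Suc c)) n) (low_col K t (Suc c))"
    using mnum_matched_up_eq_mnum_matched_down[OF finite_long_col fin_K finite_low_col] by simp
  then show ?case using Suc.IH[of "Suc c"] by simp
qed

text \<open>Here the right-to-left and the left-to-right constructions meet: cutting
  \<open>K 0\<close> at \<open>t\<close> produces a matching number with
  \<open>low_col K t 0\<close>, which is then moved across the columns.\<close>

lemma card_long_col_atMost: "card (long_col K 0 n \<inter> {..t}) = card (low_col K t n)"
proof (cases n)
  case (Suc m)
  \<comment> \<open>The cutoff \<open>Suc t\<close> turns the strict bound of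
    \<open>card_matched_up\<close> into \<open>{..t}\<close>.\<close>
  have "card (long_col K 0 n \<inter> {..t}) = mnum (long_col K (Suc 0) m) (low_col K t 0)"
    using card_matched_up[OF finite_long_col fin_K, of "Suc 0" m 0 "Suc t"] Suc
    by (simp add: lessThan_Suc_atMost)
  then show ?thesis using mnum_long_col_low_col[of 0 m t] Suc by simp
qed simp

text \<open>A matched set is no larger than the set it is matched with. Known sizes at both ends
  will fix the sizes in between.\<close>

lemma card_long_col_le:
  "card (long_col K c (n + j)) \<le> card (long_col K (c + j) n)"
proof (induction j arbitrary: c)
  case (Suc j)
  have "card (long_col K c (n + Suc j)) \<le> card (long_col K (Suc c) (n + j))"
    using card_matched_up_le[OF finite_long_col fin_K] by simp
  also have "\<dots> \<le> card (long_col K (Suc c + j) n)" by (rule Suc.IH)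
  finally show ?case by simp
qed simp

end

section \<open>Fillings with given row lengths and their column sets\<close>

text \<open>Columns are numbered from 0, so row r has entries F r 0, \<dots>, F r (len r - 1).\<close>

locale row_lengths =
  fixes len :: "nat \<Rightarrow> nat"
  assumes finite_nonempty: "finite {r. 0 < len r}" and len_0: "len 0 = 0"
begin

definition rows :: "nat \<Rightarrow> nat set" where
  "rows c = {r. c < len r}"

definition cols :: "(nat \<Rightarrow> nat \<Rightarrow> nat) \<Rightarrow> nat \<Rightarrow> nat set" where
  "cols F c = (\<lambda>r. F r c) ` rows c"

text \<open>In the presence of the first column condition, condition (4) of quasi-key tableaux is
  equivalent to the condition on type B triples, so it is common to both kinds of fillings.\<close>

definition tableau :: "(nat \<Rightarrow> nat \<Rightarrow> nat) \<Rightarrow> bool" where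
  "tableau F \<longleftrightarrow>
     (\<forall>r c. Suc c < len r \<longrightarrow> F r (Suc c) \<le> F r c) \<and>
     (\<forall>c. inj_on (\<lambda>r. F r c) (rows c)) \<and>
     (\<forall>r. 0 < len r \<longrightarrow> F r 0 = r) \<and>
     (\<forall>r s c. r < s \<and> len r < len s \<and> c < len r \<longrightarrow> F r c < F s (Suc c))"

definition atom :: "(nat \<Rightarrow> nat \<Rightarrow> nat) \<Rightarrow> bool" where
  "atom F \<longleftrightarrow> tableau F \<and>
     (\<forall>r s c. r < s \<and> len s \<le> len r \<and> Suc c < len s \<longrightarrow>
        F r c < F s (Suc c) \<or> F s (Suc c) < F r (Suc c))"

definition quasi :: "(nat \<Rightarrow> nat \<Rightarrow> nat) \<Rightarrow> bool" where
  "quasi F \<longleftrightarrow> tableau F \<and>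
     (\<forall>r s c. r < s \<and> len s \<le> len r \<and> c < len s \<and> F s c < F r c \<longrightarrow>
        Suc c < len r \<and> F s c < F r (Suc c))"

text \<open>The second condition says that the right-to-left construction ends in the prescribed
  shape. By \<open>card_long_col_atMost\<close> it also fixes the sizes of all
  \<open>low_col\<close>, so one notion serves both kinds of fillings.\<close>

definition admissible :: "(nat \<Rightarrow> nat set) \<Rightarrow> bool" where
  "admissible K \<longleftrightarrow> (\<forall>c. finite (K c) \<and> card (K c) = card (rows c)) \<and> (\<forall>n. long_col K 0 n = rows n)"

lemma finite_rows: "finite (rows c)"
  by (rule finite_subset[OF _ finite_nonempty]) (auto simp: rows_def)

lemma rows_Suc_subset: "rows (Suc c) \<subseteq> rows c"
  by (auto simp: rows_def)

lemma finite_cols: "finite (cols F c)"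
  by (simp add: cols_def finite_rows)

lemma tableau_dec: "tableau F \<Longrightarrow> r \<in> rows (Suc c) \<Longrightarrow> F r (Suc c) \<le> F r c"
  by (simp add: tableau_def rows_def)

lemma tableau_inj: "tableau F \<Longrightarrow> inj_on (\<lambda>r. F r c) (rows c)"
  by (simp add: tableau_def)

lemma tableau_col0: "tableau F \<Longrightarrow> r \<in> rows 0 \<Longrightarrow> F r 0 = r"
  by (simp add: tableau_def rows_def)

lemma tableau_longer_above:
  "tableau F \<Longrightarrow> r < s \<Longrightarrow> len r < len s \<Longrightarrow> c < len r \<Longrightarrow> F r c < F s (Suc c)"
  by (simp add: tableau_def)

lemma atomD:
  "atom F \<Longrightarrow> r < s \<Longrightarrow> len s \<le> len r \<Longrightarrow> Suc c < len s \<Longrightarrow>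
    F r c < F s (Suc c) \<or> F s (Suc c) < F r (Suc c)"
  by (simp add: atom_def)

lemma quasiD:
  "quasi F \<Longrightarrow> r < s \<Longrightarrow> len s \<le> len r \<Longrightarrow> c < len s \<Longrightarrow> F s c < F r c \<Longrightarrow>
    Suc c < len r \<and> F s c < F r (Suc c)"
  unfolding quasi_def by blast

text \<open>Weakly decreasing rows provide partners for the entries in rows up to \<open>t\<close>.
  An entry \<open>d\<close> of a higher row finds none free: if \<open>F r c\<close> is at least
  \<open>d\<close> for a row \<open>r\<close> up to \<open>t\<close>, the triple conditions make row
  \<open>r\<close> continue with an entry above \<open>d\<close>.\<close>

lemma atom_low_col:
  assumes "atom F"
  shows "low_col (cols F) t c = (\<lambda>r. F r c) ` (rows c \<inter> {..t})"
proof (induction c)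
  case 0
  \<comment> \<open>The first column lists the row indices, so bounding rows by \<open>t\<close> is
    bounding entries by \<open>t\<close>.\<close>
  have "(\<lambda>r. F r 0) ` A = A" if "A \<subseteq> rows 0" for A
    using that assms tableau_col0[of F] by (auto simp: atom_def subset_iff image_iff)
  from this[of "rows 0"] this[of "rows 0 \<inter> {..t}"] show ?case by (simp add: cols_def)
next
  case (Suc c)
  have tab: "tableau F" using assms by (simp add: atom_def)
  let ?A = "rows c \<inter> {..t}" and ?B = "rows (Suc c) \<inter> {..t}"
  let ?U = "(\<lambda>r. F r c) ` ?A" and ?X = "(\<lambda>r. F r (Suc c)) ` ?B"
  have inj: "inj_on (\<lambda>r. F r c) ?A" "inj_on (\<lambda>r. F r (Suc c)) ?B"
    using tableau_inj[OF tab] by (meson inf_le1 inj_on_subset)+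
  have "?X = matched_down (cols F (Suc c)) ?U"
  proof (rule matched_down_unique)
    show "finite (cols F (Suc c))" "finite ?U" by (simp_all add: finite_cols finite_rows)
    show "?X \<subseteq> cols F (Suc c)" by (auto simp: cols_def)
    fix d assume "d \<in> cols F (Suc c)"
    then obtain s where s: "s \<in> rows (Suc c)" "d = F s (Suc c)" by (auto simp: cols_def)
    show "d \<in> ?X \<longleftrightarrow> card (?X \<inter> {d<..}) < card (?U \<inter> {d..})"
    proof
      assume "d \<in> ?X"
      then have "?X \<inter> {d<..} \<subset> ?X \<inter> {d..}" by auto
      then have "card (?X \<inter> {d<..}) < card (?X \<inter> {d..})"
        by (intro psubset_card_mono) (auto simp: finite_rows)
      also have "\<dots> \<le> card (?U \<inter> {d..})"
        unfolding card_image_Int[OF inj(1)] card_image_Int[OF inj(2)]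
        using tableau_dec[OF tab] rows_Suc_subset
        by (intro card_mono) (auto simp: finite_rows intro: order_trans)
      finally show "card (?X \<inter> {d<..}) < card (?U \<inter> {d..})" .
    next
      assume less: "card (?X \<inter> {d<..}) < card (?U \<inter> {d..})"
      show "d \<in> ?X"
      proof (rule ccontr)
        assume "d \<notin> ?X"
        then have ts: "t < s" using s by auto
        have "r \<in> rows (Suc c) \<and> d < F r (Suc c)" if r: "r \<in> ?A" "d \<le> F r c" for r
        proof -
          have rs: "r < s" using r ts by auto
          have "\<not> len r < len s"
            using tableau_longer_above[OF tab rs, of c] r s by (auto simp: rows_def)
          then show ?thesis
            using atomD[OF assms rs, of c] r s by (auto simp: rows_def)
        qed
        then have "card (?U \<inter> {d..}) \<le> card (?X \<inter> {d<..})"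
          unfolding card_image_Int[OF inj(1)] card_image_Int[OF inj(2)]
          by (intro card_mono) (auto simp: finite_rows)
        then show False using less by simp
      qed
    qed
  qed
  then show ?case using Suc by simp
qed

text \<open>Columns are treated from right to left. Let \<open>d\<close> be an entry of a shorter
  row and let a long row \<open>r\<close> have an entry at most \<open>d\<close> in column
  \<open>c + 1\<close>. Condition (4) forces \<open>r\<close> to lie below, and then (3) forces
  \<open>F r c < d\<close>, so that this partner is taken.\<close>

lemma quasi_long_col:
  assumes "quasi F"
  shows "long_col (cols F) c n = (\<lambda>r. F r c) ` rows (c + n)"
proof (induction n arbitrary: c)
  case 0
  then show ?case by (simp add: cols_def)
next
  case (Suc n)
  have tab: "tableau F" using assms by (simp add: quasi_def)
  let ?A = "rows (Suc (c + n))"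
  let ?W = "(\<lambda>r. F r (Suc c)) ` ?A" and ?X = "(\<lambda>r. F r c) ` ?A"
  have sub: "?A \<subseteq> rows (Suc c)" "?A \<subseteq> rows c" by (auto simp: rows_def)
  have inj: "inj_on (\<lambda>r. F r c) ?A" "inj_on (\<lambda>r. F r (Suc c)) ?A"
    using tableau_inj[OF tab] sub by (meson inj_on_subset)+
  have "?X = matched_up ?W (cols F c)"
  proof (rule matched_up_unique)
    show "finite (cols F c)" "finite ?W" by (simp_all add: finite_cols finite_rows)
    show "?X \<subseteq> cols F c" using sub by (auto simp: cols_def)
    fix d assume "d \<in> cols F c"
    then obtain s where s: "s \<in> rows c" "d = F s c" by (auto simp: cols_def)
    show "d \<in> ?X \<longleftrightarrow> card (?X \<inter> {..<d}) < card (?W \<inter> {..d})"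
    proof
      assume "d \<in> ?X"
      then have "?X \<inter> {..<d} \<subset> ?X \<inter> {..d}" by auto
      then have "card (?X \<inter> {..<d}) < card (?X \<inter> {..d})"
        by (intro psubset_card_mono) (auto simp: finite_rows)
      also have "\<dots> \<le> card (?W \<inter> {..d})"
        unfolding card_image_Int[OF inj(1)] card_image_Int[OF inj(2)]
        using tableau_dec[OF tab] sub
        by (intro card_mono) (auto simp: finite_rows intro: order_trans)
      finally show "card (?X \<inter> {..<d}) < card (?W \<inter> {..d})" .
    next
      assume less: "card (?X \<inter> {..<d}) < card (?W \<inter> {..d})"
      show "d \<in> ?X"
      proof (rule ccontr)
        assume d: "d \<notin> ?X"
        then have "s \<notin> ?A" using s by auto
        have "F r c < d" if r: "r \<in> ?A" "F r (Suc c) \<le> d" for r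
        proof -
          have len: "len s < len r" "r \<noteq> s" using r \<open>s \<notin> ?A\<close> by (auto simp: rows_def)
          then have "\<not> s < r" using tableau_longer_above[OF tab, of s r c] r s by (auto simp: rows_def)
          then have "r < s" using len by simp
          then have "\<not> F s c < F r c"
            using quasiD[OF assms, of r s c] len r s by (auto simp: rows_def)
          moreover have "F r c \<noteq> d" using d r by auto
          ultimately show ?thesis using s by simp
        qed
        then have "card (?W \<inter> {..d}) \<le> card (?X \<inter> {..<d})"
          unfolding card_image_Int[OF inj(1)] card_image_Int[OF inj(2)]
          by (intro card_mono) (auto simp: finite_rows)
        then show False using less by simp
      qed
    qed
  qed
  then show ?case using Suc by simp
qed

lemma card_cols: "tableau F \<Longrightarrow> card (cols F c) = card (rows c)"
  unfolding cols_def by (rule card_image[OF tableau_inj])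

lemma admissible_if_quasi:
  assumes "quasi F"
  shows "admissible (cols F)"
proof -
  have tab: "tableau F" using assms by (simp add: quasi_def)
  have "(\<lambda>r. F r 0) ` rows n = rows n" for n
    using tableau_col0[OF tab] by (force simp: rows_def image_iff)
  then show ?thesis
    using quasi_long_col[OF assms] card_cols[OF tab] finite_cols by (simp add: admissible_def)
qed

text \<open>A finite set of numbers is determined by the sizes of its initial segments, and those of
  \<open>long_col\<close> are the sizes of the known sets \<open>low_col\<close>.\<close>

lemma admissible_if_atom:
  assumes "atom F"
  shows "admissible (cols F)"
proof -
  interpret finite_columns "cols F" by unfold_locales (rule finite_cols)
  have tab: "tableau F" using assms by (simp add: atom_def)
  have "card (long_col (cols F) 0 n \<inter> {..t}) = card (rows n \<inter> {..t})" for n t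
  proof -
    have "inj_on (\<lambda>r. F r n) (rows n \<inter> {..t})"
      using tableau_inj[OF tab] by (meson inf_le1 inj_on_subset)
    then show ?thesis
      using card_long_col_atMost[of n t] atom_low_col[OF assms]
      by (simp add: card_image)
  qed
  then have "long_col (cols F) 0 n = rows n" for n
    by (intro set_eq_if_card_atMost_eq) (auto simp: finite_rows finite_long_col)
  then show ?thesis
    using card_cols[OF tab] finite_cols by (simp add: admissible_def)
qed

end

section \<open>Uniqueness and existence of fillings with given column sets\<close>

text \<open>Both functions preserve the rank of an element, and an element of the common image is
  determined by its rank.\<close>

lemma strict_mono_on_image_unique:
  fixes f g :: "nat \<Rightarrow> nat"
  assumes "finite A" "strict_mono_on A f" "strict_mono_on A g" "f ` A = g ` A" "r \<in> A"
  shows "f r = g r"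
proof -
  have rank: "card (h ` A \<inter> {..<h r}) = card (A \<inter> {..<r})" if "strict_mono_on A h" for h :: "nat \<Rightarrow> nat"
  proof -
    have "{x \<in> A. h x \<in> {..<h r}} = A \<inter> {..<r}"
      using strict_mono_on_less[OF that] assms(5) by auto
    then show ?thesis using card_image_Int[OF strict_mono_on_imp_inj_on[OF that]] by simp
  qed
  have not_less: "\<not> x < y" if "x \<in> B" "finite B" "card (B \<inter> {..<x}) = card (B \<inter> {..<y})"
    for B :: "nat set" and x y
  proof
    assume "x < y"
    then have "B \<inter> {..<x} \<subset> B \<inter> {..<y}" using that(1) by auto
    then have "card (B \<inter> {..<x}) < card (B \<inter> {..<y})" using that(2) by (intro psubset_card_mono) auto
    then show False using that(3) by simp
  qed
  have "card (f ` A \<inter> {..<f r}) = card (f ` A \<inter> {..<g r})"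
    using rank[OF assms(2)] rank[OF assms(3)] assms(4) by simp
  moreover have "f r \<in> f ` A" "g r \<in> f ` A" using assms(4,5) by auto
  ultimately show ?thesis
    using not_less[of "f r" "f ` A" "g r"] not_less[of "g r" "f ` A" "f r"] assms(1) by simp
qed

lemma ex_strict_mono_on_image:
  fixes A B :: "nat set"
  assumes "finite A" "finite B" "card A = card B"
  shows "\<exists>h. strict_mono_on A h \<and> h ` A = B"
proof -
  obtain p where p: "bij_betw p {..<card A} A" "strict_mono_on {..<card A} p"
    using ex_bij_betw_strict_mono_card[OF assms(1)] by blast
  obtain q where q: "bij_betw q {..<card A} B" "strict_mono_on {..<card A} q"
    using ex_bij_betw_strict_mono_card[OF assms(2)] assms(3) by metis
  let ?i = "the_inv_into {..<card A} p"
  have inv: "bij_betw ?i A {..<card A}" by (rule bij_betw_the_inv_into[OF p(1)])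
  have "strict_mono_on A (q \<circ> ?i)"
  proof (rule strict_mono_onI)
    fix x y assume xy: "x \<in> A" "y \<in> A" "x < y"
    have mem: "?i x \<in> {..<card A}" "?i y \<in> {..<card A}" using inv xy by (auto simp: bij_betw_def)
    have eq: "p (?i x) = x" "p (?i y) = y"
      using xy p(1) by (auto simp: bij_betw_def f_the_inv_into_f)
    have "?i x < ?i y" using strict_mono_on_less[OF p(2) mem] eq xy by simp
    then show "(q \<circ> ?i) x < (q \<circ> ?i) y" using strict_mono_on_less[OF q(2) mem] by simp
  qed
  moreover have "(q \<circ> ?i) ` A = B"
    using inv q(1) unfolding bij_betw_def by (metis image_comp)
  ultimately show ?thesis by blast
qed

context row_lengths
begin

text \<open>Distinctness in the column leaves just the entry of row \<open>r\<close> after the lower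
  rows are removed. Hence the column sets determine an atom filling.\<close>

lemma atom_entry:
  assumes "atom F" "c < len r"
  shows "low_col (cols F) r c - low_col (cols F) (r - 1) c = {F r c}"
proof -
  \<comment> \<open>\<open>len_0\<close> excludes row 0, where \<open>r - 1\<close> would be
    \<open>r\<close> itself.\<close>
  have "0 < r" using assms(2) len_0 by (cases r) auto
  then have "rows c \<inter> {..r} = insert r (rows c \<inter> {..r - 1})"
    using assms(2) by (auto simp: rows_def)
  moreover have "inj_on (\<lambda>r. F r c) (rows c)" using assms(1) tableau_inj by (simp add: atom_def)
  then have "F r c \<notin> (\<lambda>r. F r c) ` (rows c \<inter> {..r - 1})"
    using inj_on_image_mem_iff[of "\<lambda>r. F r c" "rows c" r "rows c \<inter> {..r - 1}"] \<open>0 < r\<close> assms(2)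
    by (simp add: rows_def)
  ultimately show ?thesis unfolding atom_low_col[OF assms(1)] by (simp add: insert_Diff_if)
qed

lemma atom_unique:
  assumes "atom F" "atom G" "cols F = cols G" "c < len r"
  shows "F r c = G r c"
  using atom_entry[OF assms(1,4)] atom_entry[OF assms(2,4)] assms(3) by simp

text \<open>In the last column of rows of equal length, (3) has no right neighbour to offer, so
  entries increase upwards. Going left, an inversion in column \<open>n\<close> would give
  \<open>F s n < F r (Suc n) < F s (Suc n) \<le> F s n\<close>.\<close>

lemma quasi_strict_mono_on:
  assumes "quasi F" "c < m"
  shows "strict_mono_on {r. len r = m} (\<lambda>r. F r c)"
proof (rule strict_mono_onI, unfold mem_Collect_eq)
  have tab: "tableau F" using assms by (simp add: quasi_def)
  fix r s assume rs: "len r = m" "len s = m" "r < s"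
  have "c \<le> m - 1" using assms by simp
  then show "F r c < F s c"
  proof (induction rule: inc_induct)
    case base
    have "F r (m - 1) \<noteq> F s (m - 1)"
      using tableau_inj[OF tab, of "m - 1"] rs assms(2) inj_onD[of "\<lambda>r. F r (m - 1)" "rows (m - 1)" r s]
      by (auto simp: rows_def)
    moreover have "\<not> F s (m - 1) < F r (m - 1)"
      using quasiD[OF assms(1) rs(3), of "m - 1"] rs assms(2) by auto
    ultimately show ?case by simp
  next
    case (step n)
    have "n < m" "Suc n < m" using step by simp_all
    then have "F r n \<noteq> F s n"
      using inj_onD[OF tableau_inj[OF tab, of n], of r s] rs by (auto simp: rows_def)
    moreover have "F s (Suc n) \<le> F s n"
      using tableau_dec[OF tab, of s n] rs \<open>Suc n < m\<close> by (simp add: rows_def)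
    then have "\<not> F s n < F r (Suc n)" using step by simp
    then have "\<not> F s n < F r n"
      using quasiD[OF assms(1) rs(3), of n] rs \<open>n < m\<close> by auto
    ultimately show ?case by simp
  qed
qed

lemma quasi_level:
  assumes "quasi F"
  shows "long_col (cols F) c n - long_col (cols F) c (Suc n) = (\<lambda>r. F r c) ` {r. len r = Suc (c + n)}"
proof -
  have "inj_on (\<lambda>r. F r c) (rows c)" using assms tableau_inj by (simp add: quasi_def)
  moreover have "{r. len r = Suc (c + n)} = rows (c + n) - rows (c + Suc n)"
    by (auto simp: rows_def)
  moreover have "rows (c + n) \<subseteq> rows c" "rows (c + Suc n) \<subseteq> rows c" by (auto simp: rows_def)
  ultimately show ?thesis
    unfolding quasi_long_col[OF assms] using inj_on_image_set_diff[of "\<lambda>r. F r c" "rows c"]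
    by (metis Diff_subset order_trans)
qed

text \<open>For rows of equal length, \<open>quasi_level\<close> fixes the set of entries and
  \<open>quasi_strict_mono_on\<close> their order.\<close>

lemma quasi_unique:
  assumes "quasi F" "quasi G" "cols F = cols G" "c < len r"
  shows "F r c = G r c"
proof -
  obtain n where n: "len r = Suc (c + n)" using assms(4) less_iff_Suc_add by auto
  let ?A = "{s. len s = len r}"
  have "?A \<subseteq> rows c" using assms(4) by (auto simp: rows_def)
  then have "finite ?A" using finite_rows finite_subset by blast
  moreover have "(\<lambda>r. F r c) ` ?A = (\<lambda>r. G r c) ` ?A"
    using quasi_level[OF assms(1), of c n] quasi_level[OF assms(2), of c n] assms(3) n by simp
  ultimately show ?thesis
    using strict_mono_on_image_unique[OF _ quasi_strict_mono_on[OF assms(1,4)]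
        quasi_strict_mono_on[OF assms(2,4)]] by simp
qed

text \<open>The sizes of all \<open>low_col\<close> fit the shape, so each row adds one entry to
  every column it reaches. The atom conditions come from comparing the matchings for rows up to
  \<open>r\<close> and up to \<open>r - 1\<close>.\<close>

lemma ex_atom:
  assumes "admissible K"
  shows "\<exists>F. atom F \<and> cols F = K"
proof -
  have fin: "finite (K c)" and cardK: "card (K c) = card (rows c)"
    and long: "long_col K 0 n = rows n" for c n
    using assms by (auto simp: admissible_def)
  interpret finite_columns K by unfold_locales (rule fin)
  have K0: "K 0 = rows 0" using long[of 0] by simp
  have card_low: "card (low_col K t n) = card (rows n \<inter> {..t})" for t n
    using card_long_col_atMost long by simp
  \<comment> \<open>As \<open>atom_entry\<close> demands, row \<open>r\<close> receives the element
    gained on passing from \<open>r - 1\<close> to \<open>r\<close>.\<close>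
  define F where "F r c = the_elem (low_col K r c - low_col K (r - 1) c)" for r c
  have low: "low_col K t c = (\<lambda>r. F r c) ` (rows c \<inter> {..t})" for t c
  proof (induction t)
    case 0
    have "rows c \<inter> {..0} = {}" using len_0 by (auto simp: rows_def)
    then show ?case using card_low[of 0 c] finite_low_col[of 0 c] by simp
  next
    case (Suc t)
    let ?N = "low_col K (Suc t) c - low_col K t c"
    have sub: "low_col K t c \<subseteq> low_col K (Suc t) c" by (rule low_col_mono) simp
    have cardN: "card ?N = card (rows c \<inter> {..Suc t}) - card (rows c \<inter> {..t})"
      using card_Diff_subset[OF finite_low_col sub] card_low by simp
    show ?case
    proof (cases "Suc t \<in> rows c")
      case True
      then have "rows c \<inter> {..Suc t} = insert (Suc t) (rows c \<inter> {..t})" by auto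
      moreover from this have "card ?N = 1" using cardN finite_rows by simp
      then have "?N = {F (Suc t) c}"
        unfolding F_def by (metis card_1_singletonE diff_Suc_1 the_elem_eq)
      ultimately show ?thesis using sub Suc.IH by auto
    next
      case False
      then have eq: "rows c \<inter> {..Suc t} = rows c \<inter> {..t}" by (auto simp: le_Suc_eq)
      then have "?N = {}" using cardN finite_low_col by simp
      then show ?thesis using sub Suc.IH eq by auto
    qed
  qed
  have rows_bounded: "\<exists>N. rows c \<subseteq> {..N}" for c
    using finite_rows by (meson finite_nat_iff_bounded_le)
  have cols: "cols F c = K c" for c
  proof -
    obtain N where "rows c \<subseteq> {..N}" using rows_bounded by blast
    then have N: "rows c \<inter> {..N} = rows c" by auto
    have "low_col K N c = K c"
      using card_subset_eq[OF fin low_col_subset] card_low[of N c] cardK N by simp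
    then show ?thesis using low[of N c] N by (simp add: cols_def)
  qed
  have inj: "inj_on (\<lambda>r. F r c) (rows c)" for c
    using cols[of c] cardK[of c] finite_rows by (intro eq_card_imp_inj_on) (simp_all add: cols_def)
  have step: "low_col K r c - low_col K (r - 1) c = (if r \<in> rows c then {F r c} else {})" for r c
  proof -
    have "(rows c \<inter> {..r}) - (rows c \<inter> {..r - 1}) = (if r \<in> rows c then {r} else {})"
      using len_0 by (cases r) (auto simp: rows_def le_Suc_eq)
    moreover have "low_col K r c - low_col K (r - 1) c
        = (\<lambda>r. F r c) ` ((rows c \<inter> {..r}) - (rows c \<inter> {..r - 1}))"
      unfolding low by (rule inj_on_image_set_diff[OF inj, symmetric]) auto
    ultimately show ?thesis by simp
  qed
  have sub: "low_col K (r - 1) c \<subseteq> low_col K r c" for r c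
    by (rule low_col_mono) simp
  \<comment> \<open>The gained sets in neighbouring columns are singletons, so their domination is
    an inequality of entries.\<close>
  have dec: "F r (Suc c) \<le> F r c" if "r \<in> rows (Suc c)" for r c
  proof -
    have "r \<in> rows c" using that rows_Suc_subset by blast
    then have "card ({F r (Suc c)} \<inter> {F r (Suc c)..}) \<le> card ({F r c} \<inter> {F r (Suc c)..})"
      using card_matched_down_Diff_le[OF fin finite_low_col sub, of "Suc c" r c "F r (Suc c)"]
        step[of r "Suc c"] step[of r c] that by simp
    then show ?thesis by (cases "F r (Suc c) \<le> F r c") auto
  qed
  \<comment> \<open>The entry of row \<open>s\<close> is rejected for rows up to \<open>r\<close>
    and for rows up to \<open>r - 1\<close>. Both counts are tight, and by subtraction row
    \<open>r\<close> has as many entries from that value on in column \<open>c + 1\<close> as in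
    column \<open>c\<close>.\<close>
  have keep: "r \<in> rows (Suc c) \<and> F s (Suc c) < F r (Suc c)"
    if "r < s" "r \<in> rows c" "s \<in> rows (Suc c)" "F s (Suc c) \<le> F r c" for r s c
  proof -
    let ?d = "F s (Suc c)"
    have "?d \<notin> low_col K r (Suc c)"
      using inj_on_image_mem_iff[OF inj that(3), of "rows (Suc c) \<inter> {..r}"] that(1) unfolding low
      by simp
    moreover from this have "?d \<notin> low_col K (r - 1) (Suc c)" using sub by blast
    moreover have "?d \<in> K (Suc c)" using that(3) by (auto simp: cols [symmetric] cols_def)
    ultimately have "card (low_col K t (Suc c) \<inter> {?d..}) = card (low_col K t c \<inter> {?d..})"
      if "t = r \<or> t = r - 1" for t
      using card_matched_down_tight[OF fin finite_low_col, of ?d "Suc c" t c] that by auto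
    then have "card ((low_col K r (Suc c) - low_col K (r - 1) (Suc c)) \<inter> {?d..})
        = card ((low_col K r c - low_col K (r - 1) c) \<inter> {?d..})"
      using card_Diff_Int[OF finite_low_col sub, of r c "{?d..}"]
        card_Diff_Int[OF finite_low_col sub, of r "Suc c" "{?d..}"] by simp
    then have r: "r \<in> rows (Suc c)" "?d \<le> F r (Suc c)"
      using that(2,4) unfolding step by (auto simp: Int_insert_left split: if_splits)
    then have "F r (Suc c) \<noteq> ?d" using inj_onD[OF inj, of r "Suc c" s] that(1,3) by auto
    then show ?thesis using r by simp
  qed
  \<comment> \<open>A failure in column \<open>n\<close> would make row \<open>r\<close> continue
    and exceed row \<open>s\<close> in column \<open>n + 1\<close>. This is excluded leftwards,
    starting from the last column of row \<open>r\<close>.\<close>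
  have long_rows: "F r c < F s (Suc c)" if rs: "r < s" "len r < len s" "c < len r" for r s c
  proof -
    have next_col: "Suc n < len r \<and> F s (Suc n) < F r (Suc n)"
      if "n < len r" "\<not> F r n < F s (Suc n)" for n
      using keep[of r s n] rs that by (simp add: rows_def)
    have "c \<le> len r - 1" using rs by simp
    then show ?thesis
    proof (induction rule: inc_induct)
      case base
      show ?case
      proof (rule ccontr)
        assume "\<not> ?thesis"
        with next_col[of "len r - 1"] rs show False by simp
      qed
    next
      case (step n)
      have "F s (Suc (Suc n)) \<le> F s (Suc n)" using dec step.hyps rs by (simp add: rows_def)
      then show ?case using next_col[of n] step by linarith
    qed
  qed
  have col0: "F r 0 = r" if "r \<in> rows 0" for r
  proof -
    have "0 < r" using that len_0 by (cases r) (auto simp: rows_def)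
    then have "low_col K r 0 - low_col K (r - 1) 0 = {r}" using that K0 by auto
    then show ?thesis using step[of r 0] that by simp
  qed
  have "tableau F"
    unfolding tableau_def using dec inj col0 long_rows by (simp add: rows_def)
  moreover have "F r c < F s (Suc c) \<or> F s (Suc c) < F r (Suc c)"
    if "r < s" "len s \<le> len r" "Suc c < len s" for r s c
    using keep[of r s c] that by (cases "F s (Suc c) \<le> F r c") (auto simp: rows_def)
  ultimately have "atom F" by (simp add: atom_def)
  then show ?thesis using cols by blast
qed

text \<open>Rows are grouped by length. A group receives the entries lost when the required length
  grows by one, in the increasing order that \<open>quasi_strict_mono_on\<close> forces.\<close>

lemma ex_quasi:
  assumes "admissible K"
  shows "\<exists>F. quasi F \<and> cols F = K"
proof -
  have fin: "finite (K c)" and cardK: "card (K c) = card (rows c)"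
    and long: "long_col K 0 n = rows n" for c n
    using assms by (auto simp: admissible_def)
  interpret finite_columns K by unfold_locales (rule fin)
  \<comment> \<open>By \<open>card_long_col_le\<close> this size lies between those of
    \<open>long_col K 0 (n + c)\<close> and \<open>K (c + n)\<close>, which are equal.\<close>
  have card_long: "card (long_col K c n) = card (rows (c + n))" for c n
    using card_long_col_le[of 0 n c] card_long_col_le[of c 0 n]
      long[of "n + c"] cardK[of "c + n"] by (simp add: add.commute)
  define level where "level m = {r. len r = m}" for m
  \<comment> \<open>Meant for \<open>c < m\<close>: the entries of column \<open>c\<close> in rows
    of length \<open>m\<close>. With columns counted from 0, these rows have column
    \<open>m - 1\<close> but not column \<open>m\<close>.\<close>
  define X where "X c m = long_col K c (m - Suc c) - long_col K c (m - c)" for c m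
  have level_rows: "level m = rows (m - 1) - rows m" if "0 < m" for m
    using that by (auto simp: level_def rows_def)
  have finite_level: "finite (level m)" if "0 < m" for m
    using level_rows[OF that] finite_rows by simp
  have sub: "long_col K c (m - c) \<subseteq> long_col K c (m - Suc c)" if "c < m" for c m
    using long_col_Suc_subset[of c "m - Suc c"] that by (simp add: Suc_diff_Suc)
  have finite_X: "finite (X c m)" for c m
    by (simp add: X_def finite_long_col)
  have card_X: "card (level m) = card (X c m)" if "c < m" for c m
  proof -
    have "card (X c m) = card (rows (m - 1)) - card (rows m)"
      unfolding X_def using card_Diff_subset[OF finite_long_col sub[OF that]] card_long that
      by simp
    moreover have "rows m \<subseteq> rows (m - 1)" by (auto simp: rows_def)
    ultimately show ?thesis
      using level_rows[of m] that card_Diff_subset[OF finite_rows] by simp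
  qed
  have "\<exists>h. strict_mono_on (level m) h \<and> h ` level m = X c m" if "c < m" for c m
    using ex_strict_mono_on_image[OF finite_level finite_X card_X[OF that]] that by simp
  then obtain h where h: "\<And>c m. c < m \<Longrightarrow> strict_mono_on (level m) (h c m) \<and> h c m ` level m = X c m"
    by metis
  define F where "F r c = h c (len r) r" for r c
  have mono: "strict_mono_on (level m) (\<lambda>r. F r c)" and image: "(\<lambda>r. F r c) ` level m = X c m"
    if "c < m" for c m
  proof -
    have "\<And>r. r \<in> level m \<Longrightarrow> F r c = h c m r" by (simp add: F_def level_def)
    then show "strict_mono_on (level m) (\<lambda>r. F r c)" "(\<lambda>r. F r c) ` level m = X c m"
      using h[OF that] by (auto simp: strict_mono_on_def)
  qed
  have level_mem: "r \<in> level (len r)" for r by (simp add: level_def)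
  have F_mem: "F r c \<in> X c (len r)" if "c < len r" for r c
    using image[OF that] level_mem by blast
  have long_anti: "long_col K c n' \<subseteq> long_col K c n" if "n \<le> n'" for c n n'
    using lift_Suc_antimono_le[of "long_col K c", OF long_col_Suc_subset that] .
  have notin: "F r c \<notin> long_col K c (m - Suc c)" if "c < len r" "len r < m" for r c m
  proof -
    have "len r - c \<le> m - Suc c" using that by linarith
    then show ?thesis using F_mem[OF that(1)] long_anti unfolding X_def by blast
  qed
  have inj: "inj_on (\<lambda>r. F r c) (rows c)" for c
  proof (rule inj_onI)
    fix r s assume rs: "r \<in> rows c" "s \<in> rows c" and eq: "F r c = F s c"
    then have len: "c < len r" "c < len s" by (auto simp: rows_def)
    have "len r = len s"
    proof (rule ccontr)
      assume "len r \<noteq> len s"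
      then show False
        using notin[of c r "len s"] notin[of c s "len r"] F_mem[of c r] F_mem[of c s] eq len
        by (cases "len r < len s") (auto simp: X_def)
    qed
    then have "r \<in> level (len r)" "s \<in> level (len r)" by (auto simp: level_def)
    then show "r = s" using strict_mono_on_imp_inj_on[OF mono[OF len(1)]] eq by (auto dest: inj_onD)
  qed
  have cols: "cols F c = K c" for c
  proof (rule card_subset_eq[OF fin])
    show "cols F c \<subseteq> K c"
      using F_mem long_col_subset[of K c] by (fastforce simp: cols_def X_def rows_def)
    show "card (cols F c) = card (K c)"
      using card_image[OF inj] cardK by (simp add: cols_def)
  qed
  have card_level: "card (X c m \<inter> I) = card {r \<in> level m. F r c \<in> I}" if "c < m" for c m I
    using card_image_Int[OF strict_mono_on_imp_inj_on[OF mono[OF that]], of I] image[OF that] by simp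
  have X_Suc: "X c m = matched_up (long_col K (Suc c) (m - Suc (Suc c))) (K c)
      - matched_up (long_col K (Suc c) (m - Suc c)) (K c)" if "Suc c < m" for c m
  proof -
    have "m - Suc c = Suc (m - Suc (Suc c))" "m - c = Suc (m - Suc c)" using that by auto
    then show ?thesis unfolding X_def by (metis long_col.simps(2))
  qed
  have dec: "F r (Suc c) \<le> F r c" if r: "Suc c < len r" for r c
  proof (rule ccontr)
    assume "\<not> F r (Suc c) \<le> F r c"
    then have less: "F r c < F r (Suc c)" by simp
    let ?m = "len r" and ?t = "F r (Suc c)"
    \<comment> \<open>Below \<open>?t\<close>, column \<open>c + 1\<close> of the group has just the
      rows under \<open>r\<close>, while column \<open>c\<close> would have row \<open>r\<close>
      too. This contradicts the domination of gained elements.\<close>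
    have "card (X c ?m \<inter> {..<?t}) \<le> card (X (Suc c) ?m \<inter> {..<?t})"
      unfolding X_Suc[OF r] unfolding X_def
      by (rule card_matched_up_Diff_le[OF finite_long_col fin sub[OF r]])
    then have le: "card {s \<in> level ?m. F s c < ?t} \<le> card {s \<in> level ?m. F s (Suc c) < ?t}"
      using card_level[of c ?m "{..<?t}"] card_level[of "Suc c" ?m "{..<?t}"] r by simp
    have "{s \<in> level ?m. F s (Suc c) < ?t} = {s \<in> level ?m. s < r}"
      using strict_mono_on_less[OF mono[OF r]] level_mem by auto
    moreover have "{s \<in> level ?m. s < r} \<subset> {s \<in> level ?m. F s c < ?t}"
    proof -
      have "F s c < ?t" if "s \<in> level ?m" "s < r" for s
        using strict_mono_on_less[OF mono[of c ?m], of s r] that level_mem[of r] less r by simp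
      then show ?thesis using level_mem[of r] less by blast
    qed
    then have "card {s \<in> level ?m. s < r} < card {s \<in> level ?m. F s c < ?t}"
      using finite_level[of ?m] r by (intro psubset_card_mono) auto
    ultimately show False using le by simp
  qed
  \<comment> \<open>The entry \<open>F s c\<close> of the shorter row is rejected both for the rows
    of length at least \<open>len r\<close> and for the longer ones alone. Both counts are tight, so
    the group of row \<open>r\<close> has equally many entries up to \<open>F s c\<close> in columns
    \<open>c\<close> and \<open>c + 1\<close>.\<close>
  have keep: "F r c < F s c" if "Suc c < len r" "c < len s" "len s < len r" "F r (Suc c) \<le> F s c" for r s c
  proof -
    let ?m = "len r" and ?d = "F s c"
    have d: "?d \<in> K c" using that(2) by (auto simp: cols [symmetric] cols_def rows_def)
    have "?d \<notin> long_col K c (?m - Suc c)" "?d \<notin> long_col K c (?m - c)"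
      using notin[OF that(2,3)] sub[of c ?m] that(1) by auto
    then have nd: "?d \<notin> matched_up (long_col K (Suc c) (?m - Suc (Suc c))) (K c)"
      "?d \<notin> matched_up (long_col K (Suc c) (?m - Suc c)) (K c)"
      using that(1) by (metis Suc_diff_Suc Suc_lessD long_col.simps(2))+
    have "card (X c ?m \<inter> {..?d}) = card (X (Suc c) ?m \<inter> {..?d})"
      using card_matched_up_tight[OF finite_long_col fin d nd(1)]
        card_matched_up_tight[OF finite_long_col fin d nd(2)]
        card_Diff_Int[OF _ matched_up_mono[OF finite_long_col fin sub[OF that(1)]], of c "{..?d}"]
        card_Diff_Int[OF finite_long_col sub[OF that(1)], of "{..?d}"] fin
      unfolding X_Suc[OF that(1)] unfolding X_def by simp
    then have card_eq: "card {q \<in> level ?m. F q c \<le> ?d} = card {q \<in> level ?m. F q (Suc c) \<le> ?d}"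
      using card_level[of c ?m "{..?d}"] card_level[of "Suc c" ?m "{..?d}"] that(1) by simp
    have "{q \<in> level ?m. F q c \<le> ?d} \<subseteq> {q \<in> level ?m. F q (Suc c) \<le> ?d}"
      using that(1) by (auto simp: level_def intro!: order_trans[OF dec])
    then have "{q \<in> level ?m. F q c \<le> ?d} = {q \<in> level ?m. F q (Suc c) \<le> ?d}"
      using card_eq finite_level[of ?m] that(1) by (intro card_subset_eq) auto
    then have "F r c \<le> ?d" using that(4) level_mem[of r] by blast
    moreover have "F r c \<noteq> ?d"
      using inj_onD[OF inj, of r c s] that(1-3) by (auto simp: rows_def)
    ultimately show ?thesis by simp
  qed
  \<comment> \<open>Column 0 maps a group increasingly onto itself, hence identically.\<close>
  have col0: "F r 0 = r" if r: "0 < len r" for r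
  proof -
    have "X 0 (len r) = level (len r)" using long level_rows[OF r] by (simp add: X_def)
    then have "(\<lambda>r. F r 0) ` level (len r) = id ` level (len r)" using image[OF r] by simp
    then show ?thesis
      using strict_mono_on_image_unique[OF finite_level[OF r] mono[OF r] _ _ level_mem, of id]
      by (simp add: strict_mono_on_def)
  qed
  \<comment> \<open>The induction runs from left to right: in column 0 the entries are the row
    indices, and a failure in column \<open>c\<close> would by \<open>keep\<close> put
    \<open>F s c\<close> below \<open>F r c\<close>.\<close>
  have long_rows: "F r c < F s (Suc c)" if rs: "r < s" "len r < len s" "c < len r" for r s c
    using rs(3)
  proof (induction c)
    case 0
    then show ?case using keep[of 0 s r] col0[of r] col0[of s] rs by force
  next
    case (Suc c)
    have "F r (Suc c) \<le> F r c" using dec Suc.prems .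
    then have "F r (Suc c) < F s (Suc c)" using Suc by simp
    then show ?case using keep[of "Suc c" s r] Suc.prems rs by force
  qed
  have "tableau F"
    unfolding tableau_def using dec inj col0 long_rows by (simp add: rows_def)
  moreover have "Suc c < len r \<and> F s c < F r (Suc c)"
    if rs: "r < s" "len s \<le> len r" "c < len s" "F s c < F r c" for r s c
  proof (cases "len s = len r")
    case True
    then have "F r c < F s c"
      using strict_mono_on_less[OF mono[OF rs(3)], of r s] rs(1) by (simp add: level_def)
    then show ?thesis using rs(4) by simp
  next
    case False
    then show ?thesis using keep[of c r s] rs by force
  qed
  ultimately have "quasi F" unfolding quasi_def by blast
  then show ?thesis using cols by blast
qed

section \<open>Independence of the values outside the shape\<close>

lemma cols_cong:
  assumes "\<And>r c. c < len r \<Longrightarrow> F r c = G r c"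
  shows "cols F = cols G"
  using assms by (auto simp: cols_def rows_def)

lemma tableau_cong:
  assumes eq: "\<And>r c. c < len r \<Longrightarrow> F r c = G r c" and "tableau F"
  shows "tableau G"
proof -
  have "inj_on (\<lambda>r. G r c) (rows c)" for c
    using assms(2) inj_on_cong[of "rows c" "\<lambda>r. F r c" "\<lambda>r. G r c"] eq
    by (simp add: tableau_def rows_def)
  moreover have "G r c < G s (Suc c)" if "r < s" "len r < len s" "c < len r" for r s c
  proof -
    have "F r c < F s (Suc c)" using assms(2) that by (simp add: tableau_def)
    then show ?thesis using eq[of c r] eq[of "Suc c" s] that by simp
  qed
  moreover have "G r (Suc c) \<le> G r c" if "Suc c < len r" for r c
  proof -
    have "F r (Suc c) \<le> F r c" using assms(2) that by (simp add: tableau_def)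
    then show ?thesis using eq[of c r] eq[of "Suc c" r] that by simp
  qed
  moreover have "G r 0 = r" if "0 < len r" for r
    using assms(2) that eq[of 0 r] by (auto simp: tableau_def)
  ultimately show ?thesis by (simp add: tableau_def)
qed

lemma atom_cong:
  assumes eq: "\<And>r c. c < len r \<Longrightarrow> F r c = G r c" and "atom F"
  shows "atom G"
proof -
  have "tableau G" using tableau_cong[OF eq] assms(2) by (simp add: atom_def)
  moreover have "G r c < G s (Suc c) \<or> G s (Suc c) < G r (Suc c)"
    if "r < s" "len s \<le> len r" "Suc c < len s" for r s c
  proof -
    have "F r c < F s (Suc c) \<or> F s (Suc c) < F r (Suc c)" using assms(2) that by (simp add: atom_def)
    then show ?thesis using eq[of c r] eq[of "Suc c" r] eq[of "Suc c" s] that by simp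
  qed
  ultimately show ?thesis by (simp add: atom_def)
qed

lemma quasi_cong:
  assumes eq: "\<And>r c. c < len r \<Longrightarrow> F r c = G r c" and "quasi F"
  shows "quasi G"
proof -
  have "tableau G" using tableau_cong[OF eq] assms(2) by (simp add: quasi_def)
  moreover have "Suc c < len r \<and> G s c < G r (Suc c)"
    if "r < s" "len s \<le> len r" "c < len s" "G s c < G r c" for r s c
  proof -
    have "F s c < F r c" using eq[of c r] eq[of c s] that by simp
    then have "Suc c < len r \<and> F s c < F r (Suc c)" using assms(2) that by (simp add: quasi_def)
    then show ?thesis using eq[of "Suc c" r] eq[of c s] that by simp
  qed
  ultimately show ?thesis unfolding quasi_def by blast
qed

end

section \<open>Translation to diagrams and comparison of the generating functions\<close>

lemma diagram_iff: "(i, c) \<in> diagram a \<longleftrightarrow> 0 < c \<and> c \<le> rowlen a i"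
  by (auto simp: diagram_def rowlen_def split: if_splits)

lemma row_lengths_rowlen: "row_lengths (rowlen a)"
proof
  show "finite {r. 0 < rowlen a r}"
    by (rule finite_subset[of _ "{..length a}"]) (auto simp: rowlen_def split: if_splits)
qed (simp add: rowlen_def)

interpretation row_lengths "rowlen a" for a
  by (rule row_lengths_rowlen)

abbreviation entries :: "(nat \<times> nat \<Rightarrow> nat) \<Rightarrow> nat \<Rightarrow> nat \<Rightarrow> nat" where
  "entries S \<equiv> \<lambda>r c. S (r, Suc c)"

text \<open>A type B triple allows two orders. By induction on the column the lower entry is smaller
  than the entry of the longer row in its own column, starting from the row indices; this leaves the
  order stated in \<open>tableau\<close>.\<close>

lemma atom_filling_iff: "atom_filling a S \<longleftrightarrow> atom a (entries S)"
proof
  assume S: "atom_filling a S"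
  have dec: "S (r, Suc (Suc c)) \<le> S (r, Suc c)" if "Suc c < rowlen a r" for r c
    using S that by (simp add: atom_filling_def diagram_iff)
  have col0: "S (r, Suc 0) = r" if "0 < rowlen a r" for r
    using S that by (simp add: atom_filling_def diagram_iff)
  have type_B: "inv_cond (S (s, c)) (S (s, Suc c)) (S (r, c))"
    if "r < s" "rowlen a r < rowlen a s" "0 < c" "c \<le> rowlen a r" for r s c
    using S that by (simp add: atom_filling_def diagram_iff)
  have "S (r, Suc c) < S (s, Suc (Suc c))" if "r < s" "rowlen a r < rowlen a s" "c < rowlen a r" for r s c
    using that(3)
  proof (induction c)
    case 0
    have "inv_cond (S (s, Suc 0)) (S (s, Suc (Suc 0))) (S (r, Suc 0))"
      using type_B that(1,2) 0 by simp
    then show ?case using col0[of r] col0[of s] that(1,2) 0 by (auto simp: inv_cond_def)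
  next
    case (Suc c)
    have "inv_cond (S (s, Suc (Suc c))) (S (s, Suc (Suc (Suc c)))) (S (r, Suc (Suc c)))"
      using type_B that(1,2) Suc.prems by simp
    then show ?case using Suc dec[of c r] by (auto simp: inv_cond_def)
  qed
  moreover have "S (r, Suc c) \<noteq> S (s, Suc c)" if "r \<noteq> s" "c < rowlen a r" "c < rowlen a s" for r s c
    using S that by (simp add: atom_filling_def diagram_iff)
  then have "inj_on (\<lambda>r. S (r, Suc c)) (rows a c)" for c
    unfolding inj_on_def rows_def by blast
  moreover have "S (r, Suc c) < S (s, Suc (Suc c)) \<or> S (s, Suc (Suc c)) < S (r, Suc (Suc c))"
    if "r < s" "rowlen a s \<le> rowlen a r" "Suc c < rowlen a s" for r s c
  proof -
    have "inv_cond (S (r, Suc c)) (S (r, Suc (Suc c))) (S (s, Suc (Suc c)))"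
      using S that by (simp add: atom_filling_def diagram_iff)
    then show ?thesis by (auto simp: inv_cond_def)
  qed
  ultimately show "atom a (entries S)"
    using dec col0 by (simp add: atom_def tableau_def)
next
  assume S: "atom a (entries S)"
  have tab: "tableau a (entries S)" using S by (simp add: atom_def)
  have inv: "inv_cond (S (r, c)) (S (r, Suc c)) (S (s, Suc c))"
    if "r < s" "rowlen a s \<le> rowlen a r" "0 < c" "Suc c \<le> rowlen a s" for r s c
    using S that tableau_dec[OF tab, of r "c - 1"]
    by (cases c) (auto simp: atom_def inv_cond_def rows_def)
  have inv': "inv_cond (S (s, c)) (S (s, Suc c)) (S (r, c))"
    if "r < s" "rowlen a r < rowlen a s" "0 < c" "c \<le> rowlen a r" for r s c
    using S that tableau_dec[OF tab, of s "c - 1"]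
    by (cases c) (auto simp: atom_def tableau_def inv_cond_def rows_def)
  have dec: "S (r, Suc c) \<le> S (r, c)" if "0 < c" "Suc c \<le> rowlen a r" for r c
    using that tableau_dec[OF tab, of r "c - 1"] by (cases c) (auto simp: rows_def)
  have dist: "S (r, c) \<noteq> S (s, c)" if "r \<noteq> s" "0 < c" "c \<le> rowlen a r" "c \<le> rowlen a s" for r s c
    using that tableau_inj[OF tab, of "c - 1"] by (cases c) (auto simp: inj_on_def rows_def)
  have col0: "S (r, Suc 0) = r" if "Suc 0 \<le> rowlen a r" for r
    using that tab by (simp add: tableau_def)
  show "atom_filling a S"
    using inv inv' dec dist col0 by (simp add: atom_filling_def diagram_iff)
qed

text \<open>When the higher row is longer, (4) and weak decrease put its entry above the lower one,
  so the premise of (3) fails. The bound by the row index comes from the first column.\<close>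

lemma quasi_key_iff:
  "quasi_key a S \<and> (\<forall>i. (i, 1) \<in> diagram a \<longrightarrow> S (i, 1) = i) \<longleftrightarrow> quasi a (entries S)"
proof
  assume S: "quasi_key a S \<and> (\<forall>i. (i, 1) \<in> diagram a \<longrightarrow> S (i, 1) = i)"
  have "S (r, Suc c) \<noteq> S (s, Suc c)" if "r \<noteq> s" "c < rowlen a r" "c < rowlen a s" for r s c
    using S that by (simp add: quasi_key_def diagram_iff)
  then have "inj_on (\<lambda>r. S (r, Suc c)) (rows a c)" for c
    unfolding inj_on_def rows_def by blast
  then have "tableau a (entries S)"
    using S by (simp add: quasi_key_def tableau_def diagram_iff)
  moreover have "Suc c < rowlen a r \<and> S (s, Suc c) < S (r, Suc (Suc c))"
    if "r < s" "rowlen a s \<le> rowlen a r" "c < rowlen a s" "S (s, Suc c) < S (r, Suc c)" for r s c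
  proof -
    have "r < s \<and> (r, Suc c) \<in> diagram a \<and> (s, Suc c) \<in> diagram a \<and> S (s, Suc c) < S (r, Suc c) \<longrightarrow>
        (r, Suc c + 1) \<in> diagram a \<and> S (s, Suc c) < S (r, Suc c + 1)"
      using S unfolding quasi_key_def by blast
    then show ?thesis using that by (simp add: diagram_iff)
  qed
  ultimately show "quasi a (entries S)" unfolding quasi_def by blast
next
  assume S: "quasi a (entries S)"
  have tab: "tableau a (entries S)" using S by (simp add: quasi_def)
  have dec: "S (r, Suc c) \<le> S (r, c)" if "0 < c" "Suc c \<le> rowlen a r" for r c
    using that tableau_dec[OF tab, of r "c - 1"] by (cases c) (auto simp: rows_def)
  have dist: "S (r, c) \<noteq> S (s, c)" if "r \<noteq> s" "0 < c" "c \<le> rowlen a r" "c \<le> rowlen a s" for r s c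
    using that tableau_inj[OF tab, of "c - 1"] by (cases c) (auto simp: inj_on_def rows_def)
  have col0: "S (r, Suc 0) = r" if "Suc 0 \<le> rowlen a r" for r
    using that tab by (simp add: tableau_def)
  have bound: "S (r, c) \<le> r" if "0 < c" "c \<le> rowlen a r" for r c
    using that
  proof (induction c rule: nat_induct_non_zero)
    case 1
    then show ?case using col0[of r] by simp
  next
    case (Suc c)
    then show ?case using dec[of c r] by simp
  qed
  have four: "S (r, c) < S (s, Suc c)"
    if "r < s" "rowlen a r < rowlen a s" "0 < c" "c \<le> rowlen a r" for r s c
    using that tab by (cases c) (auto simp: tableau_def)
  have three: "Suc c \<le> rowlen a r \<and> S (s, c) < S (r, Suc c)"
    if "r < s" "0 < c" "c \<le> rowlen a r" "c \<le> rowlen a s" "S (s, c) < S (r, c)" for r s c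
  proof (cases "rowlen a r < rowlen a s")
    case True
    then show ?thesis using four[of r s c] dec[of c s] that by simp
  next
    case False
    define d where "d = c - 1"
    have c: "c = Suc d" using that(2) by (simp add: d_def)
    have "r < s \<and> rowlen a s \<le> rowlen a r \<and> d < rowlen a s \<and> S (s, Suc d) < S (r, Suc d) \<longrightarrow>
        Suc d < rowlen a r \<and> S (s, Suc d) < S (r, Suc (Suc d))"
      using S unfolding quasi_def by blast
    then show ?thesis using that c False by simp
  qed
  have three': "\<forall>r s c. r < s \<and> (r, c) \<in> diagram a \<and> (s, c) \<in> diagram a \<and> S (s, c) < S (r, c) \<longrightarrow>
      (r, c + 1) \<in> diagram a \<and> S (s, c) < S (r, c + 1)"
  proof (intro allI impI)
    fix r s c
    assume "r < s \<and> (r, c) \<in> diagram a \<and> (s, c) \<in> diagram a \<and> S (s, c) < S (r, c)"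
    then show "(r, c + 1) \<in> diagram a \<and> S (s, c) < S (r, c + 1)"
      using three[of r s c] by (simp add: diagram_iff)
  qed
  show "quasi_key a S \<and> (\<forall>i. (i, 1) \<in> diagram a \<longrightarrow> S (i, 1) = i)"
    unfolding quasi_key_def
    by (intro conjI three') (simp_all add: diagram_iff dec dist col0 bound four)
qed

text \<open>Column entries are distinct, so \<open>i\<close> occurs once in each column whose set
  contains it, and the weight depends on the column sets alone.\<close>

lemma wt_eq:
  assumes "tableau a (entries S)"
  shows "wt a S = Abs_poly_mapping (\<lambda>i. card {c. i \<in> cols a (entries S) c})"
proof -
  have "card {x \<in> diagram a. S x = i} = card {c. i \<in> cols a (entries S) c}" for i
  proof (rule bij_betw_same_card[of "\<lambda>x. snd x - 1"], rule bij_betw_imageI)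
    show "inj_on (\<lambda>x. snd x - 1) {x \<in> diagram a. S x = i}"
    proof (rule inj_onI)
      fix x y assume x: "x \<in> {x \<in> diagram a. S x = i}" and y: "y \<in> {x \<in> diagram a. S x = i}"
        and eq: "snd x - 1 = snd y - 1"
      obtain r c where x': "x = (r, Suc c)" "c < rowlen a r" "S (r, Suc c) = i"
        using x by (cases x; cases "snd x") (auto simp: diagram_iff)
      obtain s d where y': "y = (s, Suc d)" "d < rowlen a s" "S (s, Suc d) = i"
        using y by (cases y; cases "snd y") (auto simp: diagram_iff)
      have "c = d" using eq x' y' by simp
      then show "x = y" using inj_onD[OF tableau_inj[OF assms, of c], of r s] x' y' by (auto simp: rows_def)
    qed
    have "c \<in> (\<lambda>x. snd x - 1) ` {x \<in> diagram a. S x = i}" if i: "i \<in> cols a (entries S) c" for c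
    proof -
      obtain r where "c < rowlen a r" "S (r, Suc c) = i" using i by (auto simp: cols_def rows_def)
      then show ?thesis by (intro image_eqI[of _ _ "(r, Suc c)"]) (auto simp: diagram_iff)
    qed
    moreover have "snd x - 1 \<in> {c. i \<in> cols a (entries S) c}" if "x \<in> diagram a" "S x = i" for x
      using that by (cases x; cases "snd x") (auto simp: diagram_iff cols_def rows_def)
    ultimately show "(\<lambda>x. snd x - 1) ` {x \<in> diagram a. S x = i} = {c. i \<in> cols a (entries S) c}"
      by blast
  qed
  then show ?thesis by (simp add: wt_def)
qed

text \<open>Reindexing by column sets, for an abstract \<open>Q\<close> that stands for
  \<open>atom\<close> or \<open>quasi\<close>. The condition on 0 reflects that fillings have
  positive entries.\<close>

lemma genfun_eq_sum_admissible:
  assumes P: "\<And>S. P S \<longleftrightarrow> Q (entries S)"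
    and tab: "\<And>F. Q F \<Longrightarrow> tableau a F"
    and adm: "\<And>F. Q F \<Longrightarrow> admissible a (cols a F)"
    and ex: "\<And>K. admissible a K \<Longrightarrow> \<exists>F. Q F \<and> cols a F = K"
    and unique: "\<And>F G r c. Q F \<Longrightarrow> Q G \<Longrightarrow> cols a F = cols a G \<Longrightarrow> c < rowlen a r \<Longrightarrow> F r c = G r c"
    and cong: "\<And>F G. (\<And>r c. c < rowlen a r \<Longrightarrow> F r c = G r c) \<Longrightarrow> Q F \<Longrightarrow> Q G"
  shows "genfun a P = (\<Sum>K\<in>{K. admissible a K \<and> (\<forall>c. 0 \<notin> K c)}.
    Poly_Mapping.single (Abs_poly_mapping (\<lambda>i. card {c. i \<in> K c})) 1)"
  unfolding genfun_def
proof (rule sum.reindex_cong[symmetric, where l = "\<lambda>S. cols a (entries S)"])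
  show "inj_on (\<lambda>S. cols a (entries S)) {S. is_filling a S \<and> P S}"
  proof (rule inj_onI, rule ext)
    fix S T :: "nat \<times> nat \<Rightarrow> nat" and x
    assume S: "S \<in> {S. is_filling a S \<and> P S}" and T: "T \<in> {S. is_filling a S \<and> P S}"
      and eq: "cols a (entries S) = cols a (entries T)"
    show "S x = T x"
    proof (cases "x \<in> diagram a")
      case True
      then obtain r c where "x = (r, Suc c)" "c < rowlen a r"
        by (cases x; cases "snd x") (auto simp: diagram_iff)
      then show ?thesis using unique[of "entries S" "entries T"] S T eq P by simp
    next
      case False
      then show ?thesis using S T by (simp add: is_filling_def del: split_paired_All)
    qed
  qed
  show "{K. admissible a K \<and> (\<forall>c. 0 \<notin> K c)} = (\<lambda>S. cols a (entries S)) ` {S. is_filling a S \<and> P S}"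
  proof (intro equalityI subsetI)
    fix K assume "K \<in> {K. admissible a K \<and> (\<forall>c. 0 \<notin> K c)}"
    then obtain F where F: "Q F" "cols a F = K" and pos: "\<And>c. 0 \<notin> K c" using ex by auto
    \<comment> \<open>The value 0 outside the diagram is what \<open>is_filling\<close> prescribes;
      there \<open>F\<close> is arbitrary, hence the use of \<open>cong\<close> below.\<close>
    define S where "S x = (if x \<in> diagram a then F (fst x) (snd x - 1) else 0)" for x
    have S: "entries S r c = F r c" if "c < rowlen a r" for r c
      using that by (simp add: S_def diagram_iff)
    have "0 < S x" if x: "x \<in> diagram a" for x
    proof -
      obtain r c where rc: "x = (r, Suc c)" "c < rowlen a r"
        using x by (cases x; cases "snd x") (auto simp: diagram_iff)
      then have "S x \<in> K c" using S F(2) by (auto simp: cols_def rows_def)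
      then show ?thesis using pos[of c] by (cases "S x") auto
    qed
    then have "is_filling a S" by (simp add: is_filling_def S_def)
    moreover have "P S" using cong[OF _ F(1), of "entries S"] S P by simp
    moreover have "cols a (entries S) = K" using cols_cong[of a "entries S" F] S F(2) by simp
    ultimately show "K \<in> (\<lambda>S. cols a (entries S)) ` {S. is_filling a S \<and> P S}" by blast
  next
    fix K assume "K \<in> (\<lambda>S. cols a (entries S)) ` {S. is_filling a S \<and> P S}"
    then obtain S where S: "is_filling a S" "P S" "K = cols a (entries S)" by blast
    have "S (r, Suc c) \<noteq> 0" if "c < rowlen a r" for r c
      using S(1) that by (simp add: is_filling_def diagram_iff)
    then have "0 \<notin> K c" for c
      unfolding S(3) cols_def rows_def by force
    then show "K \<in> {K. admissible a K \<and> (\<forall>c. 0 \<notin> K c)}" using adm S(2,3) P by simp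
  qed
  show "\<And>S. S \<in> {S. is_filling a S \<and> P S} \<Longrightarrow>
    Poly_Mapping.single (Abs_poly_mapping (\<lambda>i. card {c. i \<in> cols a (entries S) c})) 1
      = Poly_Mapping.single (wt a S) 1"
    using wt_eq tab P by simp
qed

theorem theorem3p6:
  fixes a :: "nat list"
  shows "demazure_atom a = quasi_key_poly1 a"
proof -
  have "demazure_atom a = (\<Sum>K\<in>{K. admissible a K \<and> (\<forall>c. 0 \<notin> K c)}.
    Poly_Mapping.single (Abs_poly_mapping (\<lambda>i. card {c. i \<in> K c})) 1)"
    unfolding demazure_atom_def
  proof (rule genfun_eq_sum_admissible[where Q = "atom a"])
    show "tableau a F" if "atom a F" for F using that by (simp add: atom_def)
  qed (fact atom_filling_iff admissible_if_atom ex_atom atom_unique atom_cong)+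
  moreover have "quasi_key_poly1 a = (\<Sum>K\<in>{K. admissible a K \<and> (\<forall>c. 0 \<notin> K c)}.
    Poly_Mapping.single (Abs_poly_mapping (\<lambda>i. card {c. i \<in> K c})) 1)"
    unfolding quasi_key_poly1_def
  proof (rule genfun_eq_sum_admissible[where Q = "quasi a"])
    show "tableau a F" if "quasi a F" for F using that by (simp add: quasi_def)
  qed (fact quasi_key_iff admissible_if_quasi ex_quasi quasi_unique quasi_cong)+
  ultimately show ?thesis by simp
qed

end
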